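(* Let $G=(V,E)$ be a graph with $|V|\ge 3$ and let $k\ge 2$ be an integer. The minimum cardinality $\gamma$ of a set $F$ of edges such that $(V,E\cup F)$ is $(2k,k)$-connected is equal to $$\alpha=\left\lceil \frac12\max\left\{\sum_{\mathsf{X}\in\mathcal{X}}\bigl(2k-f_G(\mathsf{X})\bigr)\right\}\right\rceil,$$ where the maximum is taken over all families $\mathcal{X}$ of non-trivial pairwise innerly-disjoint bi-sets of $V$.
   Context: All graphs are finite and undirected; loops and parallel edges are allowed (in particular the new edges in $F$ may be parallel to each other or to edges of $E$, and $E\cup F$ is understood with multiplicities). A graph is $\ell$-edge-connected if deleting any fewer than $\ell$ edges leaves it connected. A graph $G=(V,E)$ is $(2k,k)$-connected if $|V|\ge 3$, $G$ is $2k$-edge-connected, and $G-v$ is $k$-edge-connected for every $v\in V$. A bi-set of $V$ is $\mathsf{X}=(X_O,X_I)$ with $X_I\subseteq X_O\subseteq V$; its wall is $w(\mathsf{X})=X_O\setminus X_I$. It is trivial if $X_I=\emptyset$ or $X_O=V$, and non-trivial otherwise. Bi-sets $\mathsf{X},\mathsf{Y}$ are innerly-disjoint if $X_I\cap Y_I=\emptyset$. An edge enters $\mathsf{X}$ if one end-vertex is in $X_I$ and the other is not in $X_O$; $\hat d_G(\mathsf{X})$ is the number of edges of $G$ entering $\mathsf{X}$, and $f_G(\mathsf{X})=\hat d_G(\mathsf{X})+k|w(\mathsf{X})|$. The family $\mathcal{X}$ may be empty, in which case the sum is $0$. *)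

theory Defs
  imports Complex_Main "HOL-Library.Multiset" "HOL-Library.Uprod"
begin

section \<open>Finite undirected multigraphs\<close>

text \<open>
  A graph is given by its vertex set \<open>V\<close> and the multiset \<open>E\<close> of its edges. An edge is an
  unordered pair \<open>Upair u v\<close>, a loop being \<open>Upair u u\<close>; parallel edges are repeated elements
  of \<open>E\<close>. The union of edge sets with multiplicities is multiset addition.
\<close>

definition multigraph :: "'a set \<Rightarrow> 'a uprod multiset \<Rightarrow> bool" where
  "multigraph V E \<longleftrightarrow> finite V \<and> (\<forall>e\<in>#E. set_uprod e \<subseteq> V)"

definition connected_graph :: "'a set \<Rightarrow> 'a uprod multiset \<Rightarrow> bool" where
  "connected_graph V E \<longleftrightarrow> V \<noteq> {} \<and> (\<forall>u\<in>V. \<forall>v\<in>V. (u, v) \<in> {(x, y). Upair x y \<in># E}\<^sup>*)"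

definition edge_connected :: "nat \<Rightarrow> 'a set \<Rightarrow> 'a uprod multiset \<Rightarrow> bool" where
  "edge_connected l V E \<longleftrightarrow> (\<forall>D. D \<subseteq># E \<and> size D < l \<longrightarrow> connected_graph V (E - D))"

definition edges_avoiding :: "'a \<Rightarrow> 'a uprod multiset \<Rightarrow> 'a uprod multiset" where
  "edges_avoiding v E = filter_mset (\<lambda>e. v \<notin> set_uprod e) E"

definition two_k_k_connected :: "nat \<Rightarrow> 'a set \<Rightarrow> 'a uprod multiset \<Rightarrow> bool" where
  "two_k_k_connected k V E \<longleftrightarrow>
     card V \<ge> 3 \<and> edge_connected (2 * k) V E \<and>
     (\<forall>v\<in>V. edge_connected k (V - {v}) (edges_avoiding v E))"

definition augmentation :: "nat \<Rightarrow> 'a set \<Rightarrow> 'a uprod multiset \<Rightarrow> 'a uprod multiset \<Rightarrow> bool" where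
  "augmentation k V E F \<longleftrightarrow> multigraph V F \<and> two_k_k_connected k V (E + F)"

section \<open>Bi-sets\<close>

text \<open>A bi-set is the pair \<open>(X\<^sub>O, X\<^sub>I)\<close> of its outer and its inner set, in this order.\<close>

type_synonym 'a biset = "'a set \<times> 'a set"

abbreviation outer_set :: "'a biset \<Rightarrow> 'a set" where "outer_set \<equiv> fst"
abbreviation inner_set :: "'a biset \<Rightarrow> 'a set" where "inner_set \<equiv> snd"

definition is_biset :: "'a set \<Rightarrow> 'a biset \<Rightarrow> bool" where
  "is_biset V X \<longleftrightarrow> inner_set X \<subseteq> outer_set X \<and> outer_set X \<subseteq> V"

definition wall :: "'a biset \<Rightarrow> 'a set" where
  "wall X = outer_set X - inner_set X"

definition trivial_biset :: "'a set \<Rightarrow> 'a biset \<Rightarrow> bool" where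
  "trivial_biset V X \<longleftrightarrow> inner_set X = {} \<or> outer_set X = V"

definition innerly_disjoint :: "'a biset \<Rightarrow> 'a biset \<Rightarrow> bool" where
  "innerly_disjoint X Y \<longleftrightarrow> inner_set X \<inter> inner_set Y = {}"

definition enters :: "'a uprod \<Rightarrow> 'a biset \<Rightarrow> bool" where
  "enters e X \<longleftrightarrow> (\<exists>u v. e = Upair u v \<and> u \<in> inner_set X \<and> v \<notin> outer_set X)"

definition biset_degree :: "'a uprod multiset \<Rightarrow> 'a biset \<Rightarrow> nat" where
  "biset_degree E X = size (filter_mset (\<lambda>e. enters e X) E)"

definition f_biset :: "nat \<Rightarrow> 'a uprod multiset \<Rightarrow> 'a biset \<Rightarrow> nat" where
  "f_biset k E X = biset_degree E X + k * card (wall X)"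

text \<open>
  Families are sets of bi-sets: a non-trivial bi-set has a non-empty inner set, so no bi-set
  could occur twice in a pairwise innerly-disjoint family.
\<close>

definition admissible_families :: "'a set \<Rightarrow> 'a biset set set" where
  "admissible_families V =
     {\<X>. (\<forall>X\<in>\<X>. is_biset V X \<and> \<not> trivial_biset V X) \<and> pairwise innerly_disjoint \<X>}"

text \<open>
  For finite \<open>V\<close> there are finitely many admissible families, the empty one among them, so
  \<open>Max\<close> below is a genuine maximum. Single summands may be negative, hence the type \<open>int\<close>.
\<close>

lemma finite_admissible_families:
  assumes "finite V"
  shows "finite (admissible_families V)"
proof (rule finite_subset)
  show "admissible_families V \<subseteq> Pow (Pow V \<times> Pow V)"
    unfolding admissible_families_def is_biset_def by fastforce
  show "finite (Pow (Pow V \<times> Pow V))"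
    using assms by simp
qed

lemma empty_admissible: "{} \<in> admissible_families V"
  by (simp add: admissible_families_def)

definition alpha :: "nat \<Rightarrow> 'a set \<Rightarrow> 'a uprod multiset \<Rightarrow> int" where
  "alpha k V E =
     \<lceil>real_of_int (Max ((\<lambda>\<X>. \<Sum>X\<in>\<X>. 2 * int k - int (f_biset k E X)) ` admissible_families V)) / 2\<rceil>"

end

theory Submission imports Defs
begin

text \<open>
  Only bi-sets with at most one wall vertex matter, and \<open>(2k,k)\<close>-connectivity means that every
  non-trivial bi-set has \<open>f \<ge> 2k\<close>. Think of \<open>m v\<close> new edges from \<open>v\<close> to an extra vertex, where
  \<open>m\<close> is a minimal vector with \<open>f(X) + m(X\<^sub>I) \<ge> 2k\<close> for all non-trivial bi-sets \<open>X\<close>. Uncrossing the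
  bi-sets that are tight for \<open>m\<close> gives an innerly-disjoint family whose total deficiency is \<open>m(V)\<close>,
  so \<open>m(V)\<close> is the maximum in the theorem, and it remains to replace \<open>m\<close> by \<open>\<lceil>m(V)/2\<rceil>\<close> edges.

  This is done by splitting off: decrease \<open>m u\<close> and \<open>m v\<close> by one and add the edge \<open>uv\<close>. Such a
  step keeps tight bi-sets tight, hence keeps \<open>m\<close> minimal. The pair \<open>u\<close>, \<open>v\<close> can only be blocked by a
  bi-set of surplus at most one containing both, or because one vertex is the wall of a tight
  bi-set around the other. Minimality of \<open>m\<close> makes the second obstruction rare (a vertex is the
  wall of at most one maximal tight bi-set), which excludes the obstacles to splitting off known
  for arbitrary \<open>m\<close>. Counting then shows that an unblocked pair exists unless \<open>m(V) = 3\<close>, and in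
  that case any path on the three vertices is good.
\<close>

section \<open>Bi-sets and degrees\<close>

text \<open>The obstacle throughout is that uncrossing is only partly available. Union and
  intersection help while the two outer sets do not cover \<open>V\<close>; the differences help
  while neither inner set lies in the other outer set. \<open>crossing_cover\<close> settles what
  remains by comparing degrees, and its conclusions bound weights of inner sets, which is why lower
  bounds on such weights are collected before each use. Vertices of weight zero escape these
  arguments, so maximal tight bi-sets are disjoint only up to weight zero. A split costs a bi-set
  containing both vertices two units, so a blocking bi-set has surplus at most one and two of them
  have at most two. That is exactly the weight which their common vertex contributes to skew
  uncrossing, so all inequalities involved become equalities. The assumption
  \<open>k \<ge> 2\<close> enters as \<open>2 * k - 1 > k\<close>. A total weight of one cannot
  occur, so odd totals end at three; the two edges spent there are the rounding up in
  \<open>alpha\<close>.\<close>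

lemma enters_Upair [simp]:
  "enters (Upair a b) X \<longleftrightarrow>
     a \<in> inner_set X \<and> b \<notin> outer_set X \<or> b \<in> inner_set X \<and> a \<notin> outer_set X"
  by (auto simp: enters_def)

lemma biset_degree_empty [simp]: "biset_degree {#} X = 0"
  by (simp add: biset_degree_def)

lemma biset_degree_add_mset [simp]:
  "biset_degree (add_mset e E) X = of_bool (enters e X) + biset_degree E X"
  by (simp add: biset_degree_def)

lemma biset_degree_union [simp]:
  "biset_degree (E + F) X = biset_degree E X + biset_degree F X"
  by (simp add: biset_degree_def)

definition proper_biset :: "'a set \<Rightarrow> 'a biset \<Rightarrow> bool" where
  "proper_biset V X \<longleftrightarrow> is_biset V X \<and> \<not> trivial_biset V X"

definition bi_inter :: "'a biset \<Rightarrow> 'a biset \<Rightarrow> 'a biset" where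
  "bi_inter X Y = (outer_set X \<inter> outer_set Y, inner_set X \<inter> inner_set Y)"

definition bi_union :: "'a biset \<Rightarrow> 'a biset \<Rightarrow> 'a biset" where
  "bi_union X Y = (outer_set X \<union> outer_set Y, inner_set X \<union> inner_set Y)"

definition bi_diff :: "'a biset \<Rightarrow> 'a biset \<Rightarrow> 'a biset" where
  "bi_diff X Y = (outer_set X - inner_set Y, inner_set X - outer_set Y)"

definition bi_compl :: "'a set \<Rightarrow> 'a biset \<Rightarrow> 'a biset" where
  "bi_compl V X = (V - inner_set X, V - outer_set X)"

lemma bi_simps [simp]:
  "outer_set (bi_inter X Y) = outer_set X \<inter> outer_set Y"
  "inner_set (bi_inter X Y) = inner_set X \<inter> inner_set Y"
  "outer_set (bi_union X Y) = outer_set X \<union> outer_set Y"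
  "inner_set (bi_union X Y) = inner_set X \<union> inner_set Y"
  "outer_set (bi_diff X Y) = outer_set X - inner_set Y"
  "inner_set (bi_diff X Y) = inner_set X - outer_set Y"
  "outer_set (bi_compl V X) = V - inner_set X"
  "inner_set (bi_compl V X) = V - outer_set X"
  by (simp_all add: bi_inter_def bi_union_def bi_diff_def bi_compl_def)

lemma proper_biset_iff:
  "proper_biset V X \<longleftrightarrow> inner_set X \<subseteq> outer_set X \<and> outer_set X \<subset> V \<and> inner_set X \<noteq> {}"
  by (auto simp: proper_biset_def is_biset_def trivial_biset_def)

lemma biset_degree_submodular:
  assumes "inner_set X \<subseteq> outer_set X" "inner_set Y \<subseteq> outer_set Y"
  shows "biset_degree E (bi_inter X Y) + biset_degree E (bi_union X Y)
           \<le> biset_degree E X + biset_degree E Y"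
proof (induction E)
  case (add e E)
  obtain a b where "e = Upair a b" by (cases e)
  then have "of_bool (enters e (bi_inter X Y)) + of_bool (enters e (bi_union X Y))
      \<le> (of_bool (enters e X) + of_bool (enters e Y) :: nat)"
    using assms by (auto simp: of_bool_def)
  then show ?case using add.IH by simp
qed simp

text \<open>The last term counts the edges from the common inner part to the outside of both outer
  sets: they enter \<open>X\<close> and \<open>Y\<close> but neither difference. It later forces
  such edges to be absent (\<open>dangerous_pair\<close>).\<close>

lemma biset_degree_skew_submodular:
  assumes "inner_set X \<subseteq> outer_set X" "inner_set Y \<subseteq> outer_set Y"
  shows "biset_degree E (bi_diff X Y) + biset_degree E (bi_diff Y X)
           + 2 * biset_degree E (outer_set X \<union> outer_set Y, inner_set X \<inter> inner_set Y)
           \<le> biset_degree E X + biset_degree E Y"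
proof (induction E)
  case (add e E)
  obtain a b where "e = Upair a b" by (cases e)
  then have "of_bool (enters e (bi_diff X Y)) + of_bool (enters e (bi_diff Y X))
      + 2 * of_bool (enters e (outer_set X \<union> outer_set Y, inner_set X \<inter> inner_set Y))
      \<le> (of_bool (enters e X) + of_bool (enters e Y) :: nat)"
    using assms by (auto simp: of_bool_def)
  then show ?case using add.IH by simp
qed simp

lemma biset_degree_compl:
  assumes "\<forall>e\<in>#E. set_uprod e \<subseteq> V" "is_biset V X"
  shows "biset_degree E (bi_compl V X) = biset_degree E X"
  using assms(1)
proof (induction E)
  case (add e E)
  obtain a b where "e = Upair a b" by (cases e)
  then have "enters e (bi_compl V X) = enters e X"
    using assms(2) add.prems by (auto simp: is_biset_def)
  then show ?case using add by simp
qed simp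

lemma finite_biset:
  assumes "finite V" "is_biset V X"
  shows "finite (outer_set X)" "finite (inner_set X)"
  using assms unfolding is_biset_def by (meson finite_subset)+

lemma card_wall:
  assumes "finite V" "is_biset V X"
  shows "int (card (wall X)) = int (card (outer_set X)) - int (card (inner_set X))"
proof -
  have "finite (outer_set X)" "finite (inner_set X)" "inner_set X \<subseteq> outer_set X"
    using finite_biset[OF assms] assms(2) by (auto simp: is_biset_def)
  then show ?thesis
    by (simp add: wall_def card_Diff_subset of_nat_diff card_mono)
qed

lemma card_wall_inter_union:
  assumes V: "finite V" "is_biset V X" "is_biset V Y"
  shows "card (wall (bi_inter X Y)) + card (wall (bi_union X Y)) = card (wall X) + card (wall Y)"
proof -
  have b: "is_biset V (bi_inter X Y)" "is_biset V (bi_union X Y)"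
    using V by (auto simp: is_biset_def)
  have fin: "finite (outer_set X)" "finite (outer_set Y)" "finite (inner_set X)" "finite (inner_set Y)"
    using finite_biset V by blast+
  show ?thesis
    using card_Un_Int[OF fin(1,2)] card_Un_Int[OF fin(3,4)] card_wall[OF V(1) b(1)]
      card_wall[OF V(1) b(2)] card_wall[OF V(1,2)] card_wall[OF V(1,3)]
    by simp
qed

text \<open>The mixed parts, outer set of one and inner set of the other, occur once with each sign
  and cancel.\<close>

lemma card_wall_diff:
  assumes V: "finite V" "is_biset V X" "is_biset V Y"
  shows "card (wall (bi_diff X Y)) + card (wall (bi_diff Y X)) = card (wall X) + card (wall Y)"
proof -
  have b: "is_biset V (bi_diff X Y)" "is_biset V (bi_diff Y X)"
    using V by (auto simp: is_biset_def)
  have fin: "finite (outer_set X)" "finite (outer_set Y)" "finite (inner_set X)" "finite (inner_set Y)"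
    using finite_biset V by blast+
  have "card (outer_set X - inner_set Y) + card (outer_set X \<inter> inner_set Y) = card (outer_set X)"
    "card (outer_set Y - inner_set X) + card (outer_set Y \<inter> inner_set X) = card (outer_set Y)"
    "card (inner_set X - outer_set Y) + card (inner_set X \<inter> outer_set Y) = card (inner_set X)"
    "card (inner_set Y - outer_set X) + card (inner_set Y \<inter> outer_set X) = card (inner_set Y)"
    using fin by (metis card_Int_Diff add.commute)+
  then show ?thesis
    using card_wall[OF V(1) b(1)] card_wall[OF V(1) b(2)] card_wall[OF V(1,2)] card_wall[OF V(1,3)]
    by (simp add: Int_commute)
qed

lemma f_biset_submodular:
  assumes V: "finite V" "is_biset V X" "is_biset V Y"
  shows "f_biset k E (bi_inter X Y) + f_biset k E (bi_union X Y) \<le> f_biset k E X + f_biset k E Y"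
proof -
  have "k * card (wall (bi_inter X Y)) + k * card (wall (bi_union X Y)) = k * card (wall X) + k * card (wall Y)"
    using card_wall_inter_union[OF V] by (metis distrib_left)
  then show ?thesis
    using biset_degree_submodular[of X Y E] V by (simp add: f_biset_def is_biset_def)
qed

lemma f_biset_skew_submodular:
  assumes V: "finite V" "is_biset V X" "is_biset V Y"
  shows "f_biset k E (bi_diff X Y) + f_biset k E (bi_diff Y X)
    + 2 * biset_degree E (outer_set X \<union> outer_set Y, inner_set X \<inter> inner_set Y)
    \<le> f_biset k E X + f_biset k E Y"
proof -
  have "k * card (wall (bi_diff X Y)) + k * card (wall (bi_diff Y X)) = k * card (wall X) + k * card (wall Y)"
    using card_wall_diff[OF V] by (metis distrib_left)
  then show ?thesis
    using biset_degree_skew_submodular[of X Y E] V by (simp add: f_biset_def is_biset_def)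
qed

lemma wall_compl:
  assumes "is_biset V X" shows "wall (bi_compl V X) = wall X"
  using assms by (auto simp: wall_def is_biset_def)

lemma f_biset_compl:
  assumes "\<forall>e\<in>#E. set_uprod e \<subseteq> V" "is_biset V X"
  shows "f_biset k E (bi_compl V X) = f_biset k E X"
  using assms by (simp add: f_biset_def biset_degree_compl wall_compl)

lemma proper_compl: "proper_biset V X \<Longrightarrow> proper_biset V (bi_compl V X)"
  by (auto simp: proper_biset_iff)

section \<open>Connectivity as a condition on cuts and bi-sets\<close>

lemma edge_connected_iff_cuts:
  assumes "multigraph V E" "V \<noteq> {}"
  shows "edge_connected l V E \<longleftrightarrow> (\<forall>S. S \<noteq> {} \<and> S \<subset> V \<longrightarrow> l \<le> biset_degree E (S, S))"
proof (intro iffI allI impI)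
  fix S assume c: "edge_connected l V E" and S: "S \<noteq> {} \<and> S \<subset> V"
  show "l \<le> biset_degree E (S, S)"
  proof (rule ccontr)
    assume n: "\<not> ?thesis"
    define D where "D = filter_mset (\<lambda>e. enters e (S, S)) E"
    have "connected_graph V (E - D)"
      using c n by (auto simp: edge_connected_def D_def biset_degree_def)
    moreover obtain u v where uv: "u \<in> S" "v \<in> V" "v \<notin> S" using S by blast
    ultimately have "(u, v) \<in> {(x, y). Upair x y \<in># E - D}\<^sup>*"
      using S by (auto simp: connected_graph_def)
    moreover have ED: "E - D = filter_mset (\<lambda>e. \<not> enters e (S, S)) E"
      unfolding D_def by (metis add_diff_cancel_left' multiset_partition)
    ultimately have "v \<in> S"
      using uv(1) by (induction rule: rtrancl_induct) auto
    then show False using uv by simp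
  qed
next
  assume cut: "\<forall>S. S \<noteq> {} \<and> S \<subset> V \<longrightarrow> l \<le> biset_degree E (S, S)"
  show "edge_connected l V E"
    unfolding edge_connected_def connected_graph_def
  proof (intro allI impI conjI ballI)
    fix D u v assume D: "D \<subseteq># E \<and> size D < l" and u: "u \<in> V" and v: "v \<in> V"
    let ?R = "{(x, y). Upair x y \<in># E - D}"
    \<comment> \<open>The part still reachable from \<open>u\<close>: every edge leaving it was
      deleted, so its cut has at most \<open>size D\<close> edges.\<close>
    define S where "S = {x \<in> V. (u, x) \<in> ?R\<^sup>*}"
    show "(u, v) \<in> ?R\<^sup>*"
    proof (rule ccontr)
      assume "\<not> ?thesis"
      then have "u \<in> S" "v \<notin> S" "S \<subseteq> V"
        using u by (auto simp: S_def)
      then have "l \<le> biset_degree E (S, S)"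
        using cut v by blast
      moreover have "filter_mset (\<lambda>e. enters e (S, S)) (E - D) = {#}"
      proof (rule ccontr)
        assume "filter_mset (\<lambda>e. enters e (S, S)) (E - D) \<noteq> {#}"
        then obtain e where e: "e \<in># E - D" "enters e (S, S)"
          unfolding filter_mset_eq_mempty_iff by blast
        then obtain a b where ab: "e = Upair a b" "a \<in> S" "b \<notin> S"
          unfolding enters_def by auto
        have "b \<in> V"
          using e(1) ab(1) assms(1) by (auto simp: multigraph_def dest!: in_diffD)
        moreover have "(a, b) \<in> ?R" using e ab by auto
        ultimately show False using ab by (auto simp: S_def intro: rtrancl_into_rtrancl)
      qed
      then have "filter_mset (\<lambda>e. enters e (S, S)) E = filter_mset (\<lambda>e. enters e (S, S)) D"
        using D filter_union_mset[of "\<lambda>e. enters e (S, S)" D "E - D"] by simp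
      then have "biset_degree E (S, S) \<le> size D"
        by (simp add: biset_degree_def size_filter_mset_lesseq)
      ultimately show False using D by simp
    qed
  qed (use assms in auto)
qed

lemma multigraph_avoiding:
  assumes "multigraph V E" shows "multigraph (V - {v}) (edges_avoiding v E)"
  using assms by (auto simp: multigraph_def edges_avoiding_def)

lemma biset_degree_avoiding:
  assumes "v \<notin> S"
  shows "biset_degree (edges_avoiding v E) (S, S) = biset_degree E (insert v S, S)"
proof (induction E)
  case (add e E)
  obtain a b where "e = Upair a b" by (cases e)
  then show ?case using assms add.IH by (auto simp: edges_avoiding_def)
qed (simp add: edges_avoiding_def)

text \<open>The weight \<open>k\<close> per wall vertex lets one inequality encode both demands: an
  empty wall gives a cut of the graph, a wall \<open>{v}\<close> a cut of the graph without
  \<open>v\<close>, and two or more wall vertices contribute \<open>2 * k\<close> by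
  themselves.\<close>

lemma two_k_k_connected_iff:
  assumes "multigraph V E" "card V \<ge> 3"
  shows "two_k_k_connected k V E \<longleftrightarrow> (\<forall>X. proper_biset V X \<longrightarrow> 2 * k \<le> f_biset k E X)"
proof -
  have ne: "V \<noteq> {}" "V - {v} \<noteq> {}" for v
  proof -
    show "V \<noteq> {}" using assms(2) by auto
    show "V - {v} \<noteq> {}"
      using assms(2) card_mono[of "{v}" V] by auto
  qed
  show ?thesis
  proof (intro iffI allI impI)
    fix X assume c: "two_k_k_connected k V E" and X: "proper_biset V X"
    obtain U S where US: "X = (U, S)" by (cases X)
    have S: "S \<subseteq> U" "U \<subset> V" "S \<noteq> {}" using X US by (auto simp: proper_biset_iff)
    have fin: "finite (U - S)"
      using S assms by (auto simp: multigraph_def intro: finite_subset)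
    consider "U = S" | v where "U - S = {v}" | "card (U - S) \<ge> 2"
    proof -
      have "card (U - S) = 0 \<or> card (U - S) = 1 \<or> card (U - S) \<ge> 2" by linarith
      then show thesis
        using that fin S(1) by (auto simp: card_1_singleton_iff)
    qed
    then show "2 * k \<le> f_biset k E X"
    proof cases
      case 1
      have "2 * k \<le> biset_degree E (S, S)"
        using c S 1 edge_connected_iff_cuts[OF assms(1) ne(1), of "2 * k"]
        unfolding two_k_k_connected_def by blast
      then show ?thesis by (simp add: f_biset_def US 1)
    next
      case (2 v)
      then have v: "U = insert v S" "v \<notin> S" using S by auto
      then have "S \<subset> V - {v}" "v \<in> V" using S by auto
      then have "k \<le> biset_degree (edges_avoiding v E) (S, S)"
        using c S edge_connected_iff_cuts[OF multigraph_avoiding[OF assms(1)] ne(2), of k v]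
        unfolding two_k_k_connected_def by blast
      then show ?thesis
        using v biset_degree_avoiding[of v S E] 2 by (simp add: f_biset_def wall_def US)
    next
      case 3
      then have "k * 2 \<le> k * card (U - S)" by (rule mult_le_mono2)
      then have "2 * k \<le> biset_degree E X + k * card (U - S)" by linarith
      then show ?thesis by (simp add: f_biset_def wall_def US)
    qed
  next
    assume f: "\<forall>X. proper_biset V X \<longrightarrow> 2 * k \<le> f_biset k E X"
    have "edge_connected (2 * k) V E"
      unfolding edge_connected_iff_cuts[OF assms(1) ne(1)]
    proof (intro allI impI)
      fix S assume "S \<noteq> {} \<and> S \<subset> V"
      then have "proper_biset V (S, S)" by (simp add: proper_biset_iff)
      then show "2 * k \<le> biset_degree E (S, S)"
        using f by (fastforce simp: f_biset_def wall_def)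
    qed
    moreover have "edge_connected k (V - {v}) (edges_avoiding v E)" if v: "v \<in> V" for v
      unfolding edge_connected_iff_cuts[OF multigraph_avoiding[OF assms(1)] ne(2)]
    proof (intro allI impI)
      fix S assume S: "S \<noteq> {} \<and> S \<subset> V - {v}"
      then have "proper_biset V (insert v S, S)" using v by (auto simp: proper_biset_iff)
      then have "2 * k \<le> f_biset k E (insert v S, S)" using f by blast
      moreover have "wall (insert v S, S) = {v}" using S by (auto simp: wall_def)
      moreover have "v \<notin> S" using S by blast
      ultimately show "k \<le> biset_degree (edges_avoiding v E) (S, S)"
        using biset_degree_avoiding[of v S E] by (simp add: f_biset_def)
    qed
    ultimately show "two_k_k_connected k V E"
      using assms by (simp add: two_k_k_connected_def)
  qed
qed

section \<open>Extensions\<close>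

text \<open>Only the degrees \<open>m\<close> towards the imagined extra vertex are kept, not a
  graph on a larger vertex set; splitting off then just edits \<open>m\<close> and
  \<open>E\<close>.\<close>

locale extension =
  fixes V :: "'a set" and E :: "'a uprod multiset" and k :: nat and m :: "'a \<Rightarrow> nat"
  assumes multigraph: "multigraph V E"
    and k_ge_2: "2 \<le> k"
    and covers: "proper_biset V X \<Longrightarrow> 2 * k \<le> f_biset k E X + sum m (inner_set X)"
begin

definition wt :: "'a set \<Rightarrow> int" where
  "wt S = int (sum m S)"

definition surplus :: "'a biset \<Rightarrow> int" where
  "surplus X = int (f_biset k E X) + wt (inner_set X) - 2 * int k"

definition tight :: "'a biset \<Rightarrow> bool" where
  "tight X \<longleftrightarrow> proper_biset V X \<and> surplus X = 0"

lemma finite_V: "finite V"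
  using multigraph by (simp add: multigraph_def)

lemma edges_in_V: "\<forall>e\<in>#E. set_uprod e \<subseteq> V"
  using multigraph by (simp add: multigraph_def)

lemma proper_finite:
  assumes "proper_biset V X" shows "finite (outer_set X)" "finite (inner_set X)"
  using assms finite_biset[OF finite_V] by (auto simp: proper_biset_def)

lemma proper_subset:
  assumes "proper_biset V X"
  shows "inner_set X \<subseteq> outer_set X" "outer_set X \<subseteq> V" "inner_set X \<subseteq> V" "inner_set X \<noteq> {}" "outer_set X \<noteq> V"
  using assms by (auto simp: proper_biset_iff)

lemma tight_proper: "tight X \<Longrightarrow> proper_biset V X"
  by (simp add: tight_def)

lemma wt_nonneg [simp]: "0 \<le> wt S"
  unfolding wt_def by (rule of_nat_0_le_iff)

lemma wt_empty [simp]: "wt {} = 0"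
  by (simp add: wt_def)

lemma wt_mono: "S \<subseteq> T \<Longrightarrow> T \<subseteq> V \<Longrightarrow> wt S \<le> wt T"
  using finite_V by (auto simp: wt_def intro!: sum_mono2 intro: finite_subset simp del: of_nat_sum)

lemma wt_split: "S \<subseteq> V \<Longrightarrow> wt S = wt (S \<inter> T) + wt (S - T)"
  using finite_V sum.Int_Diff[of S m T] finite_subset[of S V] by (auto simp: wt_def simp del: of_nat_sum)

lemma wt_Un: "S \<subseteq> V \<Longrightarrow> T \<subseteq> V \<Longrightarrow> wt (S \<union> T) + wt (S \<inter> T) = wt S + wt T"
  using finite_V sum.union_inter[of S T m] finite_subset[of _ V]
  by (auto simp: wt_def simp del: of_nat_sum)

lemma wt_disjoint_Un: "S \<subseteq> V \<Longrightarrow> T \<subseteq> V \<Longrightarrow> S \<inter> T = {} \<Longrightarrow> wt (S \<union> T) = wt S + wt T"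
  using wt_Un[of S T] by simp

lemma wt_singleton [simp]: "wt {v} = int (m v)"
  by (simp add: wt_def)

lemma wt_ge_member: "v \<in> S \<Longrightarrow> S \<subseteq> V \<Longrightarrow> int (m v) \<le> wt S"
  using wt_mono[of "{v}" S] by simp

lemma wt_eq_0_iff: "S \<subseteq> V \<Longrightarrow> wt S = 0 \<longleftrightarrow> (\<forall>v\<in>S. m v = 0)"
  using finite_V finite_subset[of S V] by (auto simp: wt_def simp del: of_nat_sum)

lemma covers_int: "proper_biset V X \<Longrightarrow> 2 * int k \<le> int (f_biset k E X) + wt (inner_set X)"
  using covers[of X] unfolding wt_def by linarith

lemma surplus_nonneg: "proper_biset V X \<Longrightarrow> 0 \<le> surplus X"
  using covers_int[of X] by (simp add: surplus_def)

text \<open>Two wall vertices alone provide \<open>2 * k\<close>, so the whole weight of the inner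
  set would be surplus.\<close>

lemma wall_le_1:
  assumes X: "proper_biset V X" and "surplus X < wt (inner_set X)"
  shows "card (wall X) \<le> 1"
proof (rule ccontr)
  assume "\<not> ?thesis"
  then have "k * 2 \<le> k * card (wall X)" by (intro mult_le_mono2) simp
  then have "2 * k \<le> f_biset k E X" unfolding f_biset_def by linarith
  then show False using assms(2) by (simp add: surplus_def)
qed

lemma wall_cases:
  assumes "proper_biset V X" "card (wall X) \<le> 1"
  obtains "wall X = {}" "outer_set X = inner_set X"
  | t where "wall X = {t}" "outer_set X = insert t (inner_set X)" "t \<notin> inner_set X" "t \<in> V"
proof -
  have fin: "finite (wall X)" using proper_finite[OF assms(1)] by (simp add: wall_def)
  consider "wall X = {}" | t where "wall X = {t}"
  proof -
    have "card (wall X) = 0 \<or> card (wall X) = 1" using assms(2) by linarith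
    then show thesis using that fin by (auto simp: card_1_singleton_iff)
  qed
  then show thesis
  proof cases
    case 1
    then show thesis using that(1) proper_subset[OF assms(1)] by (auto simp: wall_def)
  next
    case (2 t)
    then have "outer_set X = insert t (inner_set X)" "t \<notin> inner_set X"
      using proper_subset[OF assms(1)] unfolding wall_def by blast+
    then show thesis using that(2)[OF 2] proper_subset[OF assms(1)] by auto
  qed
qed

lemma surplus_inter_union:
  assumes "proper_biset V X" "proper_biset V Y"
  shows "surplus (bi_inter X Y) + surplus (bi_union X Y) \<le> surplus X + surplus Y"
proof -
  have "wt (inner_set X \<union> inner_set Y) + wt (inner_set X \<inter> inner_set Y)
      = wt (inner_set X) + wt (inner_set Y)"
    using wt_Un proper_subset assms by metis
  moreover have "f_biset k E (bi_inter X Y) + f_biset k E (bi_union X Y) \<le> f_biset k E X + f_biset k E Y"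
    using f_biset_submodular[OF finite_V, of X Y] assms by (simp add: proper_biset_def)
  ultimately show ?thesis by (simp add: surplus_def)
qed

lemma surplus_diff:
  assumes "proper_biset V X" "proper_biset V Y"
  shows "surplus (bi_diff X Y) + surplus (bi_diff Y X)
      + wt (inner_set X \<inter> outer_set Y) + wt (inner_set Y \<inter> outer_set X)
      + 2 * int (biset_degree E (outer_set X \<union> outer_set Y, inner_set X \<inter> inner_set Y))
      \<le> surplus X + surplus Y"
proof -
  have "wt (inner_set X) = wt (inner_set X \<inter> outer_set Y) + wt (inner_set X - outer_set Y)"
    "wt (inner_set Y) = wt (inner_set Y \<inter> outer_set X) + wt (inner_set Y - outer_set X)"
    using wt_split proper_subset assms by metis+
  moreover have "f_biset k E (bi_diff X Y) + f_biset k E (bi_diff Y X)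
    + 2 * biset_degree E (outer_set X \<union> outer_set Y, inner_set X \<inter> inner_set Y) \<le> f_biset k E X + f_biset k E Y"
    using f_biset_skew_submodular[OF finite_V, of X Y] assms by (simp add: proper_biset_def)
  ultimately show ?thesis by (simp add: surplus_def)
qed

text \<open>A bi-set and its complement have the same \<open>f_biset\<close>, so the deficiency that
  \<open>m\<close> meets inside must also be met outside.\<close>

lemma wt_compl_ge:
  assumes "proper_biset V X"
  shows "wt (inner_set X) - surplus X \<le> wt (V - outer_set X)"
proof -
  have "f_biset k E (bi_compl V X) = f_biset k E X"
    using f_biset_compl[OF edges_in_V] assms by (simp add: proper_biset_def)
  then show ?thesis
    using covers_int[OF proper_compl[OF assms]] by (simp add: surplus_def)
qed

lemma proper_inter:
  "proper_biset V X \<Longrightarrow> proper_biset V Y \<Longrightarrow> inner_set X \<inter> inner_set Y \<noteq> {} \<Longrightarrow> proper_biset V (bi_inter X Y)"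
  by (auto simp: proper_biset_iff)

lemma proper_union:
  "proper_biset V X \<Longrightarrow> proper_biset V Y \<Longrightarrow> outer_set X \<union> outer_set Y \<noteq> V \<Longrightarrow> proper_biset V (bi_union X Y)"
  by (auto simp: proper_biset_iff)

lemma proper_diff:
  "proper_biset V X \<Longrightarrow> proper_biset V Y \<Longrightarrow> \<not> inner_set X \<subseteq> outer_set Y \<Longrightarrow> proper_biset V (bi_diff X Y)"
  by (auto simp: proper_biset_iff)

lemma degree_eq_surplus:
  "int (biset_degree E X) = 2 * int k + surplus X - wt (inner_set X) - int k * int (card (wall X))"
  by (simp add: surplus_def f_biset_def)

lemma degree_set_ge:
  assumes "S \<noteq> {}" "S \<subset> V"
  shows "2 * int k - wt S \<le> int (biset_degree E (S, S))"
proof -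
  have "proper_biset V (S, S)" using assms by (simp add: proper_biset_iff)
  then show ?thesis using covers_int[of "(S, S)"] by (simp add: f_biset_def wall_def)
qed

lemma degree_mono_edges:
  assumes "\<And>a b. a \<in> V \<Longrightarrow> b \<in> V \<Longrightarrow> a \<in> inner_set X \<Longrightarrow> b \<notin> outer_set X \<Longrightarrow>
     enters (Upair a b) Y \<or> enters (Upair a b) Z"
  shows "biset_degree E X \<le> biset_degree E Y + biset_degree E Z"
  using edges_in_V
proof (induction E)
  case (add e E)
  obtain a b where e: "e = Upair a b" by (cases e)
  then have "a \<in> V" "b \<in> V" using add.prems by auto
  then have "enters e X \<Longrightarrow> enters e Y \<or> enters e Z"
    using assms[of a b] assms[of b a] e by auto
  then show ?case using add by (auto simp: of_bool_def)
qed simp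

text \<open>
  The configuration in which neither uncrossing applies: \<open>V - Y\<^sub>O\<close> must then be the single wall
  vertex of \<open>X\<close>. The bounds come from comparing degrees with those of \<open>X\<^sub>I\<close> and \<open>V - X\<^sub>O\<close>.
\<close>

lemma crossing_cover:
  assumes X: "proper_biset V X" "card (wall X) \<le> 1" and Y: "proper_biset V Y" "card (wall Y) \<le> 1"
    and un: "outer_set X \<union> outer_set Y = V" and sub: "inner_set X \<subseteq> outer_set Y"
  shows "wt (inner_set X) + wt (inner_set X \<inter> inner_set Y) \<le> surplus X + surplus Y
    \<or> inner_set X \<subseteq> inner_set Y \<and>
      (wt (inner_set Y) \<le> surplus X + surplus Y
       \<or> 2 * wt (inner_set X) \<le> 2 * surplus X + surplus Y)"
proof -
  let ?A = "inner_set X" and ?B = "V - outer_set X"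
  have ne: "V - outer_set Y \<noteq> {}" using proper_subset[OF Y(1)] by blast
  then have "wall X \<noteq> {}" using un sub by (auto simp: wall_def)
  with X obtain x where x: "wall X = {x}" "outer_set X = insert x ?A" "x \<notin> ?A" "x \<in> V"
    by (metis wall_cases)
  \<comment> \<open>As the outer sets cover \<open>V\<close> and that of \<open>Y\<close> contains
    the inner set of \<open>X\<close>, only the wall vertex of \<open>X\<close> can be missing from
    it.\<close>
  then have oY: "outer_set Y = V - {x}"
    using ne un sub proper_subset[OF Y(1)] by auto
  have B: "?B \<noteq> {}" "?B \<subset> V" and A: "?A \<noteq> {}" "?A \<subset> V"
    using proper_subset[OF X(1)] x by auto
  have dX: "int (biset_degree E X) = int k + surplus X - wt ?A"
    using degree_eq_surplus[of X] x by simp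
  from Y consider "outer_set Y = inner_set Y" "wall Y = {}"
    | y where "wall Y = {y}" "outer_set Y = insert y (inner_set Y)" "y \<notin> inner_set Y" "y \<in> V"
    by (metis wall_cases)
  then show ?thesis
  proof cases
    case 1
    \<comment> \<open>An edge between \<open>?A\<close> and \<open>?B\<close> lies in both cuts and
      enters \<open>X\<close>, whence the factor two; the other edges of these cuts end in
      \<open>x\<close>, the only vertex outside \<open>Y\<close>.\<close>
    have "biset_degree E (?A, ?A) + biset_degree E (?B, ?B) \<le> 2 * biset_degree E X + biset_degree E Y"
      using edges_in_V
    proof (induction E)
      case (add e E)
      obtain a b where e: "e = Upair a b" by (cases e)
      then have "a \<in> V" "b \<in> V" using add.prems by auto
      then have "of_bool (enters e (?A, ?A)) + of_bool (enters e (?B, ?B))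
          \<le> (2 * of_bool (enters e X) + of_bool (enters e Y) :: nat)"
        using e x oY 1 sub by (auto simp: of_bool_def)
      then show ?case using add by simp
    qed simp
    moreover have "int (biset_degree E Y) = 2 * int k + surplus Y - wt ?A - wt ?B"
    proof -
      have "inner_set Y = ?A \<union> ?B" using 1 oY x A by auto
      moreover have "wt (?A \<union> ?B) = wt ?A + wt ?B"
        using x A by (intro wt_disjoint_Un) auto
      ultimately show ?thesis using degree_eq_surplus[of Y] 1 by simp
    qed
    moreover have "?A \<subseteq> inner_set Y" using 1 sub by simp
    ultimately show ?thesis
      using degree_set_ge[OF A] degree_set_ge[OF B] dX by linarith
  next
    case (2 y)
    have dY: "int (biset_degree E Y) = int k + surplus Y - wt (inner_set Y)"
      using degree_eq_surplus[of Y] 2 by simp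
    show ?thesis
    proof (cases "y \<in> ?A")
      case True
      have "biset_degree E (?B, ?B) \<le> biset_degree E X + biset_degree E Y"
        using x oY 2 True by (intro degree_mono_edges) auto
      moreover have "wt (inner_set Y) = wt (?A \<inter> inner_set Y) + wt ?B"
      proof -
        have "inner_set Y = (?A \<inter> inner_set Y) \<union> ?B" using 2 oY x A True by auto
        moreover have "wt ((?A \<inter> inner_set Y) \<union> ?B) = wt (?A \<inter> inner_set Y) + wt ?B"
          using x A by (intro wt_disjoint_Un) auto
        ultimately show ?thesis by simp
      qed
      ultimately show ?thesis using degree_set_ge[OF B] dX dY by linarith
    next
      case False
      have "biset_degree E (?A, ?A) \<le> biset_degree E X + biset_degree E Y"
        using x oY 2 False sub by (intro degree_mono_edges) auto
      moreover have "?A \<subseteq> inner_set Y" using 2 sub False by auto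
      ultimately show ?thesis using degree_set_ge[OF A] dX dY by linarith
    qed
  qed
qed

end

section \<open>Maximal tight bi-sets\<close>

definition bi_le :: "'a biset \<Rightarrow> 'a biset \<Rightarrow> bool" where
  "bi_le X Y \<longleftrightarrow> outer_set X \<subseteq> outer_set Y \<and> inner_set X \<subseteq> inner_set Y"

text \<open>An edge of the cut of \<open>A\<close> that does not enter
  \<open>(insert t A, A)\<close> ends in \<open>t\<close>. As \<open>A\<close> and \<open>B\<close>
  are disjoint, the cut of \<open>{t}\<close> pays for such edges of both.\<close>

lemma biset_degree_common_neighbour:
  assumes disj: "A \<inter> B = {}" and t: "t \<notin> A" "t \<notin> B"
  shows "biset_degree E (A, A) + biset_degree E (B, B)
    \<le> biset_degree E (insert t A, A) + biset_degree E (insert t B, B) + biset_degree E ({t}, {t})"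
proof (induction E)
  case (add e E)
  obtain a b where e: "e = Upair a b" by (cases e)
  consider "a \<in> A" "a \<notin> B" "a \<noteq> t" | "a \<in> B" "a \<notin> A" "a \<noteq> t" | "a = t" | "a \<notin> A" "a \<notin> B" "a \<noteq> t"
    using assms by blast
  then have "of_bool (enters e (A, A)) + of_bool (enters e (B, B))
      \<le> (of_bool (enters e (insert t A, A)) + of_bool (enters e (insert t B, B)) + of_bool (enters e ({t}, {t})) :: nat)"
    using t disj unfolding e by cases auto
  then show ?case using add.IH unfolding biset_degree_add_mset by linarith
qed simp

context extension
begin

lemma maximal_biset:
  assumes "P X" and P: "\<And>Y. P Y \<Longrightarrow> proper_biset V Y"
  obtains M where "P M" "bi_le X M" "\<And>Y. P Y \<Longrightarrow> bi_le M Y \<Longrightarrow> Y = M"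
proof -
  let ?size = "\<lambda>Y. card (outer_set Y) + card (inner_set Y)"
  let ?Q = "\<lambda>Y. P Y \<and> bi_le X Y"
  have "?Q X" using assms(1) by (simp add: bi_le_def)
  moreover have "\<forall>Y. ?Q Y \<longrightarrow> ?size Y < Suc (2 * card V)"
  proof (intro allI impI)
    fix Y assume "?Q Y"
    then have "outer_set Y \<subseteq> V" "inner_set Y \<subseteq> V" using proper_subset[OF P[of Y]] by auto
    then show "?size Y < Suc (2 * card V)"
      using card_mono[OF finite_V, of "outer_set Y"] card_mono[OF finite_V, of "inner_set Y"] by linarith
  qed
  ultimately have "\<exists>M. ?Q M \<and> (\<forall>Y. ?Q Y \<longrightarrow> ?size Y \<le> ?size M)"
    by (rule Lattices_Big.ex_has_greatest_nat)
  then obtain M where M: "?Q M" "\<And>Y. ?Q Y \<Longrightarrow> ?size Y \<le> ?size M"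
    by blast
  show thesis
  proof (rule that)
    fix Y assume Y: "P Y" "bi_le M Y"
    have "bi_le X Y" using Y(2) M(1) unfolding bi_le_def by blast
    then have "?size Y \<le> ?size M" using M(2) Y(1) by blast
    moreover have sub: "outer_set M \<subseteq> outer_set Y" "inner_set M \<subseteq> inner_set Y"
      using Y by (auto simp: bi_le_def)
    moreover have fin: "finite (outer_set Y)" "finite (inner_set Y)"
      using proper_finite[OF P[OF Y(1)]] by auto
    ultimately have "card (outer_set Y) \<le> card (outer_set M)" "card (inner_set Y) \<le> card (inner_set M)"
      using card_mono[OF fin(1) sub(1)] card_mono[OF fin(2) sub(2)] by linarith+
    then show "Y = M"
      using card_seteq[OF fin(1) sub(1)] card_seteq[OF fin(2) sub(2)] by (simp add: prod_eq_iff)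
  qed (use M in auto)
qed

definition supp :: "'a set" where
  "supp = {v \<in> V. 0 < m v}"

lemma supp_V: "v \<in> supp \<Longrightarrow> v \<in> V"
  by (simp add: supp_def)

lemma finite_supp: "finite supp"
  using finite_V by (simp add: supp_def)

lemma wt_inter_supp: "S \<subseteq> V \<Longrightarrow> wt (S \<inter> supp) = wt S"
proof -
  assume S: "S \<subseteq> V"
  then have "wt (S - supp) = 0" by (intro wt_eq_0_iff[THEN iffD2]) (auto simp: supp_def)
  then show "wt (S \<inter> supp) = wt S" using wt_split[OF S, of supp] by simp
qed

lemma wt_mono_supp: "S \<subseteq> V \<Longrightarrow> T \<subseteq> V \<Longrightarrow> S \<inter> supp \<subseteq> T \<Longrightarrow> wt S \<le> wt T"
  using wt_mono[of "S \<inter> supp" T] wt_inter_supp[of S] by simp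

lemma wt_ge_1: "v \<in> supp \<Longrightarrow> v \<in> S \<Longrightarrow> S \<subseteq> V \<Longrightarrow> 1 \<le> wt S"
  using wt_ge_member[of v S] by (auto simp: supp_def)

lemma wt_ge_2: "u \<in> supp \<Longrightarrow> v \<in> supp \<Longrightarrow> u \<noteq> v \<Longrightarrow> u \<in> S \<Longrightarrow> v \<in> S \<Longrightarrow> S \<subseteq> V \<Longrightarrow> 2 \<le> wt S"
  using wt_split[of S "{u}"] wt_ge_1[of u "S \<inter> {u}"] wt_ge_1[of v "S - {u}"] by fastforce

lemma wt_pos_obtain:
  assumes "0 < wt S" "S \<subseteq> V"
  obtains v where "v \<in> supp" "v \<in> S"
  using assms wt_eq_0_iff[of S] by (auto simp: supp_def)

lemma tight_wall:
  assumes "tight X" "u \<in> supp" "u \<in> inner_set X"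
  shows "card (wall X) \<le> 1"
  using assms wall_le_1[of X] wt_ge_1[of u "inner_set X"] proper_subset[of X] by (auto simp: tight_def)

text \<open>If the outer sets covered \<open>V\<close>, then \<open>crossing_cover\<close> with
  surplus zero would exclude each inclusion of an inner set in the other outer set; so both
  differences would be proper, and \<open>surplus_diff\<close> leaves no room for the weight of
  \<open>u\<close>.\<close>

lemma tight_crossing:
  assumes X: "tight X" and Y: "tight Y" and u: "u \<in> supp" "u \<in> inner_set X" "u \<in> inner_set Y"
  shows "outer_set X \<union> outer_set Y \<noteq> V"
proof
  assume un: "outer_set X \<union> outer_set Y = V"
  have pX: "proper_biset V X" "surplus X = 0" and pY: "proper_biset V Y" "surplus Y = 0"
    using X Y by (auto simp: tight_def)
  have ge: "1 \<le> wt (inner_set X)" "1 \<le> wt (inner_set Y)" "1 \<le> wt (inner_set X \<inter> inner_set Y)"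
    "1 \<le> wt (inner_set X \<inter> outer_set Y)"
    using u proper_subset[OF pX(1)] proper_subset[OF pY(1)] by (auto intro!: wt_ge_1[of u])
  have "\<not> inner_set X \<subseteq> outer_set Y"
    using crossing_cover[OF pX(1) tight_wall[OF X u(1,2)] pY(1) tight_wall[OF Y u(1,3)] un] ge pX pY
    by linarith
  moreover have "\<not> inner_set Y \<subseteq> outer_set X"
    using crossing_cover[OF pY(1) tight_wall[OF Y u(1,3)] pX(1) tight_wall[OF X u(1,2)]] un ge pX pY
    by (smt (verit) Int_commute Un_commute)
  ultimately have "0 \<le> surplus (bi_diff X Y)" "0 \<le> surplus (bi_diff Y X)"
    using proper_diff pX pY surplus_nonneg by blast+
  then show False using surplus_diff[OF pX(1) pY(1)] pX pY ge wt_nonneg[of "inner_set Y \<inter> outer_set X"]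
    by linarith
qed

lemma tight_union:
  assumes X: "tight X" and Y: "tight Y" and ne: "inner_set X \<inter> inner_set Y \<noteq> {}"
    and un: "outer_set X \<union> outer_set Y \<noteq> V"
  shows "tight (bi_union X Y)"
proof -
  have p: "proper_biset V X" "surplus X = 0" "proper_biset V Y" "surplus Y = 0"
    using X Y by (auto simp: tight_def)
  have u: "proper_biset V (bi_union X Y)" using proper_union[OF p(1,3) un] .
  then show ?thesis
    using surplus_nonneg[OF u] surplus_nonneg[OF proper_inter[OF p(1,3) ne]]
      surplus_inter_union[OF p(1,3)] p by (simp add: tight_def)
qed

text \<open>The largest tight bi-set around \<open>u\<close>. The choice is determined once a
  largest one exists, as it does for \<open>u\<close> in \<open>supp\<close> when \<open>m\<close>
  is minimal.\<close>

definition tight_hull :: "'a \<Rightarrow> 'a biset" where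
  "tight_hull u = (SOME M. tight M \<and> u \<in> inner_set M \<and> (\<forall>X. tight X \<and> u \<in> inner_set X \<longrightarrow> bi_le X M))"

end

text \<open>Minimality is encoded by a tight witness at each vertex instead of a comparison of
  vectors, because the witnesses survive splitting off.\<close>

locale minimal_extension = extension +
  assumes tight_at: "v \<in> V \<Longrightarrow> 0 < m v \<Longrightarrow> \<exists>X. tight X \<and> v \<in> inner_set X"
begin

text \<open>Two tight bi-sets around \<open>u\<close> have a tight union, since
  \<open>tight_crossing\<close> keeps their outer sets from covering \<open>V\<close>; so a maximal
  one contains all others.\<close>

lemma tight_hull:
  assumes "u \<in> supp"
  shows "tight (tight_hull u)" "u \<in> inner_set (tight_hull u)"
    and tight_hull_max: "tight X \<Longrightarrow> u \<in> inner_set X \<Longrightarrow> bi_le X (tight_hull u)"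
proof -
  let ?P = "\<lambda>X. tight X \<and> u \<in> inner_set X"
  obtain T where "?P T" using tight_at[of u] assms by (auto simp: supp_def)
  then obtain M where M: "?P M" "\<And>Y. ?P Y \<Longrightarrow> bi_le M Y \<Longrightarrow> Y = M"
    using maximal_biset[of ?P T] tight_proper by blast
  have "bi_le Y M" if "?P Y" for Y
  proof -
    have "tight (bi_union M Y)"
      using tight_union[of M Y] tight_crossing[of M Y u] assms M that by blast
    then have "bi_union M Y = M" using M that by (auto simp: bi_le_def)
    then show ?thesis by (metis bi_le_def bi_simps(3,4) sup_ge2)
  qed
  then have "\<exists>M. tight M \<and> u \<in> inner_set M \<and> (\<forall>X. tight X \<and> u \<in> inner_set X \<longrightarrow> bi_le X M)"
    using M by blast
  from someI_ex[OF this]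
  show "tight (tight_hull u)" "u \<in> inner_set (tight_hull u)"
    "tight X \<Longrightarrow> u \<in> inner_set X \<Longrightarrow> bi_le X (tight_hull u)"
    unfolding tight_hull_def by blast+
qed

lemma hull_proper: "u \<in> supp \<Longrightarrow> proper_biset V (tight_hull u)"
  and hull_surplus: "u \<in> supp \<Longrightarrow> surplus (tight_hull u) = 0"
  and hull_wall: "u \<in> supp \<Longrightarrow> card (wall (tight_hull u)) \<le> 1"
  using tight_hull(1)[of u] tight_hull(2)[of u] tight_wall[of "tight_hull u" u]
  by (simp_all add: tight_def)

lemma hull_subset:
  "u \<in> supp \<Longrightarrow> inner_set (tight_hull u) \<subseteq> V" "u \<in> supp \<Longrightarrow> outer_set (tight_hull u) \<subseteq> V"
  "u \<in> supp \<Longrightarrow> inner_set (tight_hull u) \<subseteq> outer_set (tight_hull u)"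
  by (simp_all add: hull_proper proper_subset)

lemma hull_eq:
  assumes "u \<in> supp" "v \<in> supp" "v \<in> inner_set (tight_hull u)"
  shows "tight_hull v = tight_hull u"
proof -
  have 1: "bi_le (tight_hull u) (tight_hull v)"
    using assms tight_hull tight_hull_max by blast
  then have "u \<in> inner_set (tight_hull v)" using tight_hull(2)[of u] assms by (auto simp: bi_le_def)
  then have "bi_le (tight_hull v) (tight_hull u)"
    using assms tight_hull tight_hull_max by blast
  with 1 show ?thesis by (auto simp: bi_le_def prod_eq_iff)
qed

lemma hull_eq_iff:
  "u \<in> supp \<Longrightarrow> v \<in> supp \<Longrightarrow> tight_hull u = tight_hull v \<longleftrightarrow> v \<in> inner_set (tight_hull u)"
  using hull_eq tight_hull(2) by metis

text \<open>A common vertex of positive weight would have both bi-sets as its hull. The argument is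
  silent on vertices of weight zero, whence disjointness only in weight.\<close>

lemma hull_disjoint:
  assumes "u \<in> supp" "v \<in> supp" "tight_hull u \<noteq> tight_hull v"
  shows "wt (inner_set (tight_hull u) \<inter> inner_set (tight_hull v)) = 0"
proof (rule ccontr)
  assume "\<not> ?thesis"
  then have "0 < wt (inner_set (tight_hull u) \<inter> inner_set (tight_hull v))"
    using wt_nonneg by (metis order_le_less)
  then obtain x where x: "x \<in> supp" "x \<in> inner_set (tight_hull u) \<inter> inner_set (tight_hull v)"
    using wt_pos_obtain hull_subset(1)[OF assms(1)] by (metis le_infI1)
  then have "tight_hull x = tight_hull u" "tight_hull x = tight_hull v"
    using hull_eq[OF assms(1) x(1)] hull_eq[OF assms(2) x(1)] by auto
  then show False using assms(3) by simp
qed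

lemma hull_wt_pos: "u \<in> supp \<Longrightarrow> 1 \<le> wt (inner_set (tight_hull u))"
  using wt_ge_1[of u "inner_set (tight_hull u)"] tight_hull(2)[of u] hull_subset(1)[of u] by blast

text \<open>Lets a blocking bi-set absorb the hulls of the vertices it blocks. The second vertex
  \<open>v\<close> gives \<open>D\<close> weight at least two and keeps its inner set from lying
  inside that of the hull, which defeats every alternative of \<open>crossing_cover\<close>.\<close>

lemma dangerous_union_hull:
  assumes D: "proper_biset V D" "surplus D \<le> 1" and u: "u \<in> supp" "u \<in> inner_set D"
    and v: "v \<in> supp" "v \<in> inner_set D" "v \<notin> inner_set (tight_hull u)"
  shows "proper_biset V (bi_union D (tight_hull u)) \<and> surplus (bi_union D (tight_hull u)) \<le> 1"
proof -
  let ?M = "tight_hull u"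
  have M: "proper_biset V ?M" "surplus ?M = 0" "card (wall ?M) \<le> 1" "u \<in> inner_set ?M"
    using u hull_proper hull_surplus hull_wall tight_hull(2) by auto
  have sD: "2 \<le> wt (inner_set D)"
    using u v M proper_subset[OF D(1)] by (intro wt_ge_2[of u v]) auto
  have wD: "card (wall D) \<le> 1" using wall_le_1[OF D(1)] D(2) sD by simp
  have ge: "1 \<le> wt (inner_set ?M)" "1 \<le> wt (inner_set ?M \<inter> inner_set D)" "1 \<le> wt (inner_set D \<inter> inner_set ?M)"
    "1 \<le> wt (inner_set D \<inter> outer_set ?M)" "1 \<le> wt (inner_set ?M \<inter> outer_set D)"
    using u M proper_subset[OF D(1)] proper_subset[OF M(1)] by (auto intro!: wt_ge_1[of u])
  have "outer_set D \<union> outer_set ?M \<noteq> V"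
  proof
    assume un: "outer_set D \<union> outer_set ?M = V"
    have "\<not> inner_set D \<subseteq> outer_set ?M"
      using crossing_cover[OF D(1) wD M(1,3) un] ge sD D M v by auto
    moreover have "\<not> inner_set ?M \<subseteq> outer_set D"
      using crossing_cover[OF M(1,3) D(1) wD] un ge sD D M by (auto simp: Un_commute)
    ultimately have "0 \<le> surplus (bi_diff D ?M)" "0 \<le> surplus (bi_diff ?M D)"
      using proper_diff D M surplus_nonneg by blast+
    then show False using surplus_diff[OF D(1) M(1)] D M ge by linarith
  qed
  then have p: "proper_biset V (bi_union D ?M)" using proper_union D M by blast
  have "proper_biset V (bi_inter D ?M)" using proper_inter[OF D(1) M(1)] u M by auto
  then show ?thesis
    using surplus_inter_union[OF D(1) M(1)] surplus_nonneg[of "bi_inter D ?M"] D M p by auto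
qed

section \<open>Hulls whose wall is a vertex of positive weight\<close>

lemma wall_crossing:
  assumes X: "tight X" and Z: "tight Z" and w: "wall X = {t}"
    and t: "t \<in> supp" "t \<in> inner_set Z"
  shows "inner_set X \<subseteq> outer_set Z \<or> inner_set Z \<subseteq> outer_set X"
\<comment> \<open>Otherwise both differences are proper, while \<open>t\<close>, a wall vertex of
  \<open>X\<close> inside \<open>Z\<close>, adds positive weight to a skew inequality whose
  right-hand side is zero.\<close>
proof (rule ccontr)
  assume "\<not> ?thesis"
  then have "0 \<le> surplus (bi_diff X Z)" "0 \<le> surplus (bi_diff Z X)"
    using proper_diff X Z surplus_nonneg by (auto simp: tight_def)
  moreover have "1 \<le> wt (inner_set Z \<inter> outer_set X)"
    using w t proper_subset[OF tight_proper[OF Z]] by (intro wt_ge_1[of t]) (auto simp: wall_def)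
  ultimately show False
    using surplus_diff[OF tight_proper[OF X] tight_proper[OF Z]] X Z
      wt_nonneg[of "inner_set X \<inter> outer_set Z"] by (simp add: tight_def)
qed

text \<open>The two bi-sets are nested by \<open>wall_crossing\<close>. What remains to be excluded
  is a wall vertex of the hull of \<open>t\<close> outside the inner set of
  \<open>X\<close>.\<close>

lemma wall_of_wall_hull:
  assumes X: "tight X" "wall X = {t}" "0 < wt (inner_set X)" and t: "t \<in> supp"
    and disj: "wt (inner_set X \<inter> inner_set (tight_hull t)) = 0"
  shows "wall (tight_hull t) = {} \<and> inner_set (tight_hull t) \<subseteq> outer_set X \<or>
    (\<exists>z \<in> inner_set X. wall (tight_hull t) = {z} \<and>
       (inner_set X \<subseteq> outer_set (tight_hull t) \<or> inner_set (tight_hull t) \<subseteq> outer_set X))"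
proof -
  let ?Z = "tight_hull t"
  have Z: "tight ?Z" "t \<in> inner_set ?Z" using tight_hull[OF t] by auto
  have pX: "proper_biset V X" and pZ: "proper_biset V ?Z"
    using tight_proper[OF X(1)] tight_proper[OF Z(1)] by auto
  note dich = wall_crossing[OF X(1) Z(1) X(2) t Z(2)]
  have ninner: "\<not> inner_set X \<subseteq> inner_set ?Z"
  proof
    assume "inner_set X \<subseteq> inner_set ?Z"
    then have "inner_set X \<inter> inner_set ?Z = inner_set X" by blast
    then show False using disj X(3) by simp
  qed
  show ?thesis
    using pZ hull_wall[OF t]
  proof (cases rule: wall_cases)
    case 1
    then have "inner_set ?Z \<subseteq> outer_set X" using dich ninner by blast
    then show ?thesis using 1(1) by blast
  next
    case (2 z)
    have "z \<in> inner_set X"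
    proof (cases "inner_set X \<subseteq> outer_set ?Z")
      case True
      then show ?thesis using ninner unfolding 2(2) by blast
    next
      case False
      then have ZX: "inner_set ?Z \<subseteq> outer_set X" using dich by blast
      show ?thesis
      proof (rule ccontr)
        assume z: "z \<notin> inner_set X"
        \<comment> \<open>Every edge leaving \<open>?A\<close> enters \<open>X\<close> or
          \<open>?Z\<close>. These degrees add up to \<open>2 * k\<close> minus both inner weights,
          whereas the cut of \<open>?A\<close> needs \<open>2 * k\<close> minus the inner weight of
          \<open>X\<close> alone.\<close>
        let ?A = "inner_set X - outer_set ?Z"
        have oX: "outer_set X = insert t (inner_set X)"
          using X(2) proper_subset[OF pX] by (auto simp: wall_def)
        have "biset_degree E (?A, ?A) \<le> biset_degree E X + biset_degree E ?Z"
        proof (rule degree_mono_edges)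
          fix a b assume "a \<in> inner_set (?A, ?A)" "b \<notin> outer_set (?A, ?A)"
          then have "a \<in> inner_set X" "a \<notin> outer_set ?Z" "b \<notin> inner_set X \<or> b \<in> outer_set ?Z"
            by auto
          moreover from this(3) have "b \<notin> outer_set X \<or> b = t \<or> b \<in> inner_set ?Z"
            using z unfolding oX 2(2) by blast
          ultimately show "enters (Upair a b) X \<or> enters (Upair a b) ?Z"
            using Z(2) unfolding enters_Upair by blast
        qed
        moreover have "wt ?A = wt (inner_set X)"
        proof -
          have "inner_set X \<inter> outer_set ?Z = inner_set X \<inter> inner_set ?Z"
            using z unfolding 2(2) by blast
          then show ?thesis
            using wt_split[of "inner_set X" "outer_set ?Z"] disj proper_subset[OF pX] by simp
        qed
        moreover have "2 * int k - wt ?A \<le> int (biset_degree E (?A, ?A))"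
        proof (rule degree_set_ge)
          show "?A \<noteq> {}" using False by blast
          show "?A \<subset> V" using proper_subset(1,2,5)[OF pX] by blast
        qed
        moreover have "int (biset_degree E X) = int k - wt (inner_set X)"
          using degree_eq_surplus[of X] X(1) unfolding X(2) by (simp add: tight_def)
        moreover have "int (biset_degree E ?Z) = int k - wt (inner_set ?Z)"
          using degree_eq_surplus[of ?Z] hull_surplus[OF t] unfolding 2(1) by simp
        ultimately show False using hull_wt_pos[OF t] by linarith
      qed
    qed
    moreover have c: "wall ?Z = {z} \<and> (inner_set X \<subseteq> outer_set ?Z \<or> inner_set ?Z \<subseteq> outer_set X)"
      using 2(1) dich by (rule conjI)
    ultimately have "\<exists>z \<in> inner_set X. wall ?Z = {z} \<and>
        (inner_set X \<subseteq> outer_set ?Z \<or> inner_set ?Z \<subseteq> outer_set X)"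
      by (rule rev_bexI)
    then show ?thesis by (rule disjI2)
  qed
qed

text \<open>
  The bi-set \<open>X\<close> sends at least \<open>k\<close> edges to its wall \<open>t\<close>, and so does \<open>Y\<close>, which is too many for the
  tight bi-set around \<open>t\<close>.
\<close>

lemma disjoint_common_wall:
  assumes X: "tight X" "wall X = {t}" "0 < wt (inner_set X)" "wt (inner_set X \<inter> inner_set (tight_hull t)) = 0"
    and Y: "tight Y" "wall Y = {t}" "0 < wt (inner_set Y)" "wt (inner_set Y \<inter> inner_set (tight_hull t)) = 0"
    and t: "t \<in> supp" and disj: "inner_set X \<inter> inner_set Y = {}"
  shows False
proof -
  let ?Z = "tight_hull t"
  have p: "proper_biset V X" "proper_biset V Y" "proper_biset V ?Z"
    using tight_proper[OF X(1)] tight_proper[OF Y(1)] hull_proper[OF t] by auto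
  have o: "outer_set X = insert t (inner_set X)" "outer_set Y = insert t (inner_set Y)"
    using X(2) Y(2) proper_subset[OF p(1)] proper_subset[OF p(2)] by (auto simp: wall_def)
  have nt: "t \<notin> inner_set X" "t \<notin> inner_set Y" using X(2) Y(2) by (auto simp: wall_def)
  note WX = wall_of_wall_hull[OF X(1-3) t X(4)] and WY = wall_of_wall_hull[OF Y(1-3) t Y(4)]
  \<comment> \<open>A wall vertex of \<open>?Z\<close> would lie in both of the disjoint inner
    sets.\<close>
  have wZ: "wall ?Z = {}"
  proof (rule ccontr)
    assume "wall ?Z \<noteq> {}"
    then obtain z where z: "z \<in> inner_set X" "wall ?Z = {z}" using WX by blast
    obtain z' where z': "z' \<in> inner_set Y" "wall ?Z = {z'}" using WY \<open>wall ?Z \<noteq> {}\<close> by blast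
    have "z = z'" using z(2) z'(2) by simp
    then show False using disj z(1) z'(1) by blast
  qed
  then have "inner_set ?Z \<subseteq> outer_set X" "inner_set ?Z \<subseteq> outer_set Y"
    using WX WY by simp_all
  then have "inner_set ?Z \<subseteq> {t}" using disj unfolding o by blast
  then have Z1: "inner_set ?Z = {t}" using tight_hull(2)[OF t] by blast
  have "outer_set ?Z = inner_set ?Z"
    using wZ proper_subset(1)[OF p(3)] unfolding wall_def by blast
  then have "outer_set ?Z = {t}" using Z1 by (rule trans)
  note Z = Z1 this wZ
  let ?A = "inner_set X" and ?B = "inner_set Y"
  have "(insert t ?A, ?A) = X" "(insert t ?B, ?B) = Y" "({t}, {t}) = ?Z"
    by (rule prod_eqI; simp add: o Z)+
  with biset_degree_common_neighbour[OF disj nt, of E]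
  have "biset_degree E (?A, ?A) + biset_degree E (?B, ?B)
      \<le> biset_degree E X + biset_degree E Y + biset_degree E ?Z"
    by (simp only:)
  moreover have "2 * int k - wt ?A \<le> int (biset_degree E (?A, ?A))" "2 * int k - wt ?B \<le> int (biset_degree E (?B, ?B))"
  proof -
    show "2 * int k - wt ?A \<le> int (biset_degree E (?A, ?A))"
      by (rule degree_set_ge) (use proper_subset(1,2,4,5)[OF p(1)] in blast)+
    show "2 * int k - wt ?B \<le> int (biset_degree E (?B, ?B))"
      by (rule degree_set_ge) (use proper_subset(1,2,4,5)[OF p(2)] in blast)+
  qed
  moreover have "int (biset_degree E X) = int k - wt ?A" "int (biset_degree E Y) = int k - wt ?B"
    "int (biset_degree E ?Z) = 2 * int k - wt {t}"
  proof -
    show "int (biset_degree E X) = int k - wt ?A"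
      using degree_eq_surplus[of X] X(1) unfolding X(2) by (simp add: tight_def)
    show "int (biset_degree E Y) = int k - wt ?B"
      using degree_eq_surplus[of Y] Y(1) unfolding Y(2) by (simp add: tight_def)
    show "int (biset_degree E ?Z) = 2 * int k - wt {t}"
      using degree_eq_surplus[of ?Z] hull_surplus[OF t] unfolding Z(1) Z(3) by simp
  qed
  \<comment> \<open>After cancelling the weights of \<open>?A\<close> and \<open>?B\<close>, the
    bounds read \<open>4 * k \<le> 4 * k - wt {t}\<close>.\<close>
  moreover have "1 \<le> wt {t}" using t unfolding supp_def by simp
  ultimately show False by linarith
qed

text \<open>When the inner sets meet, the two differences replace the hulls: skew uncrossing keeps
  them tight, they still have wall \<open>{t}\<close> and positive weight, and their inner sets are
  disjoint, as \<open>disjoint_common_wall\<close> demands.\<close>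

lemma common_wall:
  assumes u: "u \<in> supp" and v: "v \<in> supp" and t: "t \<in> supp"
    and w: "wall (tight_hull u) = {t}" "wall (tight_hull v) = {t}"
  shows "tight_hull u = tight_hull v"
proof (rule ccontr)
  let ?X = "tight_hull u" and ?Y = "tight_hull v" and ?Z = "tight_hull t"
  assume ne: "?X \<noteq> ?Y"
  have p: "proper_biset V ?X" "proper_biset V ?Y" using u v hull_proper by auto
  have nt: "t \<notin> inner_set ?X" "t \<notin> inner_set ?Y" using w by (auto simp: wall_def)
  have o: "outer_set ?X = insert t (inner_set ?X)" "outer_set ?Y = insert t (inner_set ?Y)"
    using w proper_subset[OF p(1)] proper_subset[OF p(2)] by (auto simp: wall_def)
  have Z0: "wt (inner_set ?X \<inter> inner_set ?Z) = 0" "wt (inner_set ?Y \<inter> inner_set ?Z) = 0"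
    using hull_disjoint[OF u t] hull_disjoint[OF v t] nt hull_eq_iff[OF u t] hull_eq_iff[OF v t] by auto
  show False
  proof (cases "inner_set ?X \<inter> inner_set ?Y = {}")
    case True
    then show False
      using disjoint_common_wall[OF tight_hull(1)[OF u] w(1) _ Z0(1) tight_hull(1)[OF v] w(2) _ Z0(2) t]
        hull_wt_pos[OF u] hull_wt_pos[OF v] by linarith
  next
    case False
    have "outer_set ?X \<union> outer_set ?Y = V"
    proof (rule ccontr)
      assume "\<not> ?thesis"
      then have "tight (bi_union ?X ?Y)"
        using tight_union[OF tight_hull(1)[OF u] tight_hull(1)[OF v] False] by blast
      then have "bi_le (bi_union ?X ?Y) ?X" using tight_hull_max[OF u] tight_hull(2)[OF u] by simp
      then show False using tight_hull(2)[OF v] ne hull_eq_iff[OF u v] by (auto simp: bi_le_def)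
    qed
    have mem: "u \<in> inner_set ?X" "v \<in> inner_set ?Y" "u \<notin> inner_set ?Y" "v \<notin> inner_set ?X"
      using ne hull_eq_iff[OF u v] hull_eq_iff[OF v u] tight_hull(2)[OF u] tight_hull(2)[OF v] by auto
    let ?X' = "bi_diff ?X ?Y" and ?Y' = "bi_diff ?Y ?X"
    have p': "proper_biset V ?X'" "proper_biset V ?Y'"
      using mem nt o by (auto intro!: proper_diff p)
    then have "0 \<le> surplus ?X'" "0 \<le> surplus ?Y'" by (simp_all add: surplus_nonneg)
    then have "surplus ?X' = 0" "surplus ?Y' = 0"
      using surplus_diff[OF p] hull_surplus[OF u] hull_surplus[OF v] wt_nonneg[of "inner_set ?X \<inter> outer_set ?Y"]
        wt_nonneg[of "inner_set ?Y \<inter> outer_set ?X"] by linarith+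
    then have T: "tight ?X'" "tight ?Y'" using p' by (simp_all add: tight_def)
    have W: "wall ?X' = {t}" "wall ?Y' = {t}" using o nt by (auto simp: wall_def)
    have P: "0 < wt (inner_set ?X')" "0 < wt (inner_set ?Y')"
      using wt_ge_1[OF u, of "inner_set ?X'"] wt_ge_1[OF v, of "inner_set ?Y'"] mem o nt
        proper_subset[OF p'(1)] proper_subset[OF p'(2)] by auto
    have "wt (inner_set ?X' \<inter> inner_set ?Z) \<le> 0" "wt (inner_set ?Y' \<inter> inner_set ?Z) \<le> 0"
      using wt_mono[of "inner_set ?X' \<inter> inner_set ?Z" "inner_set ?X \<inter> inner_set ?Z"]
        wt_mono[of "inner_set ?Y' \<inter> inner_set ?Z" "inner_set ?Y \<inter> inner_set ?Z"]
        Z0 hull_subset(1)[OF u] hull_subset(1)[OF v] by auto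
    then have Z': "wt (inner_set ?X' \<inter> inner_set ?Z) = 0" "wt (inner_set ?Y' \<inter> inner_set ?Z) = 0"
      by (simp_all add: order_antisym)
    show False
      using disjoint_common_wall[OF T(1) W(1) P(1) Z'(1) T(2) W(2) P(2) Z'(2) t] o by auto
  qed
qed

text \<open>The second obstruction to splitting off \<open>u\<close> and \<open>v\<close>: such a
  hull would lose one unit of weight, while the new edge ends in its wall and does not enter
  it.\<close>

definition wall_related :: "'a \<Rightarrow> 'a \<Rightarrow> bool" where
  "wall_related u v \<longleftrightarrow> wall (tight_hull u) = {v} \<or> wall (tight_hull v) = {u}"

lemma wall_related_commute: "wall_related u v \<longleftrightarrow> wall_related v u"
  by (auto simp: wall_related_def)

text \<open>By \<open>wall_of_wall_hull\<close> for the hull of \<open>x\<close> and its wall vertex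
  \<open>u\<close>: the hull of \<open>u\<close> has a wall, so its vertex \<open>v\<close> lies
  inside the hull of \<open>x\<close>.\<close>

lemma wall_of_wall:
  assumes "u \<in> supp" "v \<in> supp" "x \<in> supp" "wall (tight_hull u) = {v}" "wall (tight_hull x) = {u}"
  shows "tight_hull v = tight_hull x"
proof -
  have "u \<notin> inner_set (tight_hull x)" using assms(5) by (auto simp: wall_def)
  then have "wt (inner_set (tight_hull x) \<inter> inner_set (tight_hull u)) = 0"
    using hull_disjoint[OF assms(3,1)] hull_eq_iff[OF assms(3,1)] by blast
  then have "v \<in> inner_set (tight_hull x)"
    using wall_of_wall_hull[OF tight_hull(1)[OF assms(3)] assms(5) _ assms(1)] hull_wt_pos[OF assms(3)]
    unfolding assms(4) by auto
  then show ?thesis using hull_eq[OF assms(3,2)] by blast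
qed

text \<open>The obstruction ties \<open>u\<close> to a single hull only: a hull has at most one wall
  vertex, \<open>common_wall\<close> is the converse, and \<open>wall_of_wall\<close> settles the
  mixed cases.\<close>

lemma wall_related_class:
  assumes "u \<in> supp" "v \<in> supp" "x \<in> supp" "wall_related u v" "wall_related u x"
  shows "tight_hull v = tight_hull x"
proof -
  consider "wall (tight_hull u) = {v}" "wall (tight_hull u) = {x}"
    | "wall (tight_hull u) = {v}" "wall (tight_hull x) = {u}"
    | "wall (tight_hull v) = {u}" "wall (tight_hull u) = {x}"
    | "wall (tight_hull v) = {u}" "wall (tight_hull x) = {u}"
    using assms(4,5) unfolding wall_related_def by blast
  then show ?thesis
  proof cases
    case 1
    then show ?thesis by simp
  next
    case 2
    then show ?thesis using wall_of_wall[OF assms(1-3)] by blast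
  next
    case 3
    then show ?thesis using wall_of_wall[OF assms(1,3,2)] by simp
  next
    case 4
    then show ?thesis using common_wall[OF assms(2,3,1)] by blast
  qed
qed

end

section \<open>Dangerous bi-sets\<close>

text \<open>The situation to be refuted: no admissible split exists. Pairs inside one hull are left
  out because the hull itself blocks them.\<close>

locale blocked_extension = minimal_extension +
  assumes blocked: "\<lbrakk>u \<in> supp; v \<in> supp; tight_hull u \<noteq> tight_hull v; \<not> wall_related u v\<rbrakk> \<Longrightarrow>
      \<exists>D. proper_biset V D \<and> surplus D \<le> 1 \<and> u \<in> inner_set D \<and> v \<in> inner_set D"
begin

text \<open>The whole hull of \<open>u\<close> is required so that it also lies in the intersection
  of two such bi-sets; \<open>dangerous_union_hull\<close> enlarges blocking bi-sets
  accordingly.\<close>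

definition dangerous :: "'a \<Rightarrow> 'a biset \<Rightarrow> bool" where
  "dangerous u D \<longleftrightarrow> proper_biset V D \<and> surplus D \<le> 1 \<and> bi_le (tight_hull u) D"

definition max_dangerous :: "'a \<Rightarrow> 'a biset \<Rightarrow> bool" where
  "max_dangerous u D \<longleftrightarrow> dangerous u D \<and> (\<forall>D'. dangerous u D' \<and> bi_le D D' \<longrightarrow> D' = D)"

lemma dangerous_mem: "u \<in> supp \<Longrightarrow> dangerous u D \<Longrightarrow> u \<in> inner_set D"
  using tight_hull(2)[of u] by (auto simp: dangerous_def bi_le_def)

lemma max_dangerousD: "max_dangerous u D \<Longrightarrow> dangerous u D"
  by (simp add: max_dangerous_def)

lemma ex_max_dangerous:
  assumes "u \<in> supp" "v \<in> supp" "tight_hull u \<noteq> tight_hull v" "\<not> wall_related u v"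
  obtains D where "max_dangerous u D" "bi_le (tight_hull v) D"
proof -
  obtain D where D: "proper_biset V D" "surplus D \<le> 1" "u \<in> inner_set D" "v \<in> inner_set D"
    using blocked[OF assms] by blast
  have nm: "v \<notin> inner_set (tight_hull u)" "u \<notin> inner_set (tight_hull v)"
    using assms hull_eq_iff by metis+
  let ?D1 = "bi_union D (tight_hull u)"
  have D1: "proper_biset V ?D1" "surplus ?D1 \<le> 1"
    using dangerous_union_hull[OF D(1,2) assms(1) D(3) assms(2) D(4) nm(1)] by auto
  let ?D2 = "bi_union ?D1 (tight_hull v)"
  have D2: "proper_biset V ?D2" "surplus ?D2 \<le> 1"
    using dangerous_union_hull[OF D1 assms(2) _ assms(1) _ nm(2)] D by auto
  have "dangerous u ?D2" using D2 by (auto simp: dangerous_def bi_le_def)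
  then obtain M where M: "dangerous u M" "bi_le ?D2 M" "\<And>Y. dangerous u Y \<Longrightarrow> bi_le M Y \<Longrightarrow> Y = M"
    using maximal_biset[of "dangerous u" ?D2] unfolding dangerous_def by blast
  then show thesis using that[of M] by (auto simp: max_dangerous_def bi_le_def)
qed

lemma dangerous_facts:
  assumes u: "u \<in> supp" and D: "dangerous u D" and a: "a \<in> supp" "a \<in> inner_set D" "a \<noteq> u"
  shows "proper_biset V D" "surplus D \<le> 1" "2 \<le> wt (inner_set D)" "card (wall D) \<le> 1"
proof -
  show D': "proper_biset V D" "surplus D \<le> 1" using D by (auto simp: dangerous_def)
  show "2 \<le> wt (inner_set D)"
    using wt_ge_2[OF u a(1) a(3)[symmetric] dangerous_mem[OF u D] a(2)] proper_subset[OF D'(1)] by blast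
  then show "card (wall D) \<le> 1" using wall_le_1[OF D'(1)] D'(2) by linarith
qed

text \<open>The vertex \<open>b\<close> makes the union strictly larger than \<open>D\<close>, so by
  maximality its surplus is at least two; submodularity charges this to the intersection.\<close>

lemma dangerous_union:
  assumes u: "u \<in> supp" and D: "max_dangerous u D" and Y: "dangerous u Y"
    and b: "b \<in> inner_set Y" "b \<notin> inner_set D" and un: "outer_set D \<union> outer_set Y \<noteq> V"
  shows "surplus (bi_inter D Y) \<le> surplus D + surplus Y - 2" "proper_biset V (bi_inter D Y)"
    "bi_le (tight_hull u) (bi_inter D Y)"
proof -
  have D': "dangerous u D" using D by (rule max_dangerousD)
  have p: "proper_biset V D" "proper_biset V Y" using D' Y by (auto simp: dangerous_def)
  have "bi_union D Y \<noteq> D" using b by (metis UnCI bi_simps(4))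
  moreover have "proper_biset V (bi_union D Y)" using proper_union[OF p un] .
  moreover have "bi_le D (bi_union D Y)" "bi_le (tight_hull u) (bi_union D Y)"
    using D' by (auto simp: bi_le_def dangerous_def)
  ultimately have "1 < surplus (bi_union D Y)"
    using D unfolding max_dangerous_def dangerous_def by (metis not_le)
  then show "surplus (bi_inter D Y) \<le> surplus D + surplus Y - 2"
    using surplus_inter_union[OF p] by linarith
  show "bi_le (tight_hull u) (bi_inter D Y)"
    using D' Y by (auto simp: bi_le_def dangerous_def)
  have "inner_set D \<inter> inner_set Y \<noteq> {}"
    using dangerous_mem[OF u D'] dangerous_mem[OF u Y] by blast
  then show "proper_biset V (bi_inter D Y)" using proper_inter[OF p] by blast
qed

text \<open>If \<open>a\<close> were in both inner sets, then either the intersection is tight and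
  hence inside the hull of \<open>u\<close>, which misses \<open>a\<close>, or the outer sets cover
  \<open>V\<close> and the joint weight of \<open>u\<close> and \<open>a\<close> is too large for
  skew uncrossing.\<close>

lemma dangerous_separate:
  assumes u: "u \<in> supp" and D: "max_dangerous u D" and Y: "dangerous u Y"
    and a: "a \<in> supp" "a \<in> inner_set D" "tight_hull a \<noteq> tight_hull u"
    and b: "b \<in> supp" "b \<in> inner_set Y" "b \<notin> inner_set D"
  shows "a \<notin> inner_set Y"
proof
  assume aY: "a \<in> inner_set Y"
  have D': "dangerous u D" using D by (rule max_dangerousD)
  have uu: "u \<in> inner_set D" "u \<in> inner_set Y" using dangerous_mem u D' Y by auto
  have au: "a \<noteq> u" "a \<notin> inner_set (tight_hull u)" using a hull_eq_iff[OF u a(1)] by auto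
  have bu: "b \<noteq> u" "b \<noteq> a" using b uu a by auto
  note fD = dangerous_facts[OF u D' a(1,2) au(1)] and fY = dangerous_facts[OF u Y a(1) aY au(1)]
  have sub: "inner_set D \<subseteq> V" "inner_set Y \<subseteq> V" "inner_set D \<subseteq> outer_set D" "inner_set Y \<subseteq> outer_set Y"
    using proper_subset[OF fD(1)] proper_subset[OF fY(1)] by auto
  have i2: "2 \<le> wt (inner_set D \<inter> inner_set Y)"
    using wt_ge_2[OF u a(1) au(1)[symmetric], of "inner_set D \<inter> inner_set Y"] uu a aY sub by auto
  \<comment> \<open>The two surpluses may add up to two, so excluding the bound on the inner weight
    of \<open>Y\<close> in \<open>crossing_cover\<close> takes a third unit, supplied by
    \<open>b\<close>.\<close>
  have Y3: "3 \<le> wt (inner_set Y)"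
  proof -
    have "inner_set Y - inner_set D \<subseteq> V" using sub by auto
    then have "1 \<le> wt (inner_set Y - inner_set D)" using wt_ge_1[OF b(1)] b by auto
    then show ?thesis using wt_split[OF sub(2), of "inner_set D"] i2 by (simp add: Int_commute)
  qed
  show False
  proof (cases "outer_set D \<union> outer_set Y = V")
    case False
    note du = dangerous_union[OF u D Y b(2,3) False]
    then have "tight (bi_inter D Y)"
      using fD fY surplus_nonneg[OF du(2)] by (simp add: tight_def)
    then have "bi_le (bi_inter D Y) (tight_hull u)"
      using tight_hull_max[OF u] uu by simp
    then show False using a aY au by (auto simp: bi_le_def)
  next
    case True
    have "\<not> inner_set D \<subseteq> outer_set Y"
      using crossing_cover[OF fD(1,4) fY(1,4) True] i2 Y3 fD fY by auto
    moreover have "\<not> inner_set Y \<subseteq> outer_set D"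
      using crossing_cover[OF fY(1,4) fD(1,4)] True i2 Y3 fD fY b by (auto simp: Un_commute Int_commute)
    ultimately have "0 \<le> surplus (bi_diff D Y)" "0 \<le> surplus (bi_diff Y D)"
      using proper_diff fD fY surplus_nonneg by blast+
    moreover have "2 \<le> wt (inner_set D \<inter> outer_set Y)" "2 \<le> wt (inner_set Y \<inter> outer_set D)"
      using wt_ge_2[OF u a(1) au(1)[symmetric], of "inner_set D \<inter> outer_set Y"]
        wt_ge_2[OF u a(1) au(1)[symmetric], of "inner_set Y \<inter> outer_set D"] uu a aY sub by auto
    ultimately show False using surplus_diff[OF fD(1) fY(1)] fD(2) fY(2) by linarith
  qed
qed

text \<open>A tight intersection lies in the hull of \<open>u\<close>, so the inclusion would put
  \<open>a\<close> into the wall of that hull. Tightness of the intersection is a premise so that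
  the lemma serves both orders of \<open>D\<close> and \<open>Y\<close>.\<close>

lemma dangerous_not_subset:
  assumes u: "u \<in> supp" and D: "dangerous u D" and Y: "dangerous u Y"
    and a: "a \<in> supp" "a \<in> inner_set D" "a \<notin> inner_set Y" "tight_hull a \<noteq> tight_hull u" "\<not> wall_related u a"
    and b: "b \<in> supp" "b \<in> inner_set Y" "b \<noteq> u"
    and inter: "outer_set D \<union> outer_set Y \<noteq> V \<Longrightarrow> tight (bi_inter D Y)"
  shows "\<not> inner_set D \<subseteq> outer_set Y"
proof
  assume sub: "inner_set D \<subseteq> outer_set Y"
  have uu: "u \<in> inner_set D" "u \<in> inner_set Y" using dangerous_mem u D Y by auto
  have au: "a \<noteq> u" "a \<notin> inner_set (tight_hull u)" using a hull_eq_iff[OF u a(1)] by auto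
  note fD = dangerous_facts[OF u D a(1,2) au(1)] and fY = dangerous_facts[OF u Y b]
  show False
  proof (cases "outer_set D \<union> outer_set Y = V")
    case True
    have "1 \<le> wt (inner_set D \<inter> inner_set Y)"
      using wt_ge_1[OF u, of "inner_set D \<inter> inner_set Y"] uu proper_subset[OF fD(1)] by auto
    then show False
      using crossing_cover[OF fD(1,4) fY(1,4) True sub] fD fY a by auto
  next
    case False
    then have "bi_le (bi_inter D Y) (tight_hull u)"
      using tight_hull_max[OF u inter] uu by simp
    then have "a \<in> outer_set (tight_hull u)"
      using a sub proper_subset[OF fD(1)] by (auto simp: bi_le_def)
    then have "wall (tight_hull u) = {a}"
      using au wall_cases[OF hull_proper[OF u] hull_wall[OF u]] by (metis insertE)
    then show False using a by (simp add: wall_related_def)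
  qed
qed

text \<open>Each overlap contains the inner set of the hull of \<open>u\<close> and weighs at least
  one, while the surpluses add up to at most two: skew uncrossing holds with equality in every term.
  The tight intersection comes from \<open>dangerous_union\<close>.\<close>

lemma dangerous_pair:
  assumes u: "u \<in> supp" and D: "max_dangerous u D" and Y: "dangerous u Y"
    and a: "a \<in> supp" "a \<in> inner_set D" "tight_hull a \<noteq> tight_hull u" "\<not> wall_related u a"
    and b: "b \<in> supp" "b \<in> inner_set Y" "b \<notin> inner_set D" "\<not> wall_related u b"
  shows "wt (inner_set (tight_hull u)) = 1" "wt (inner_set D \<inter> outer_set Y) = 1" "wt (inner_set Y \<inter> outer_set D) = 1"
    "tight (bi_diff D Y)" "a \<in> inner_set D - outer_set Y"
    "biset_degree E (outer_set D \<union> outer_set Y, inner_set D \<inter> inner_set Y) = 0"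
    "outer_set D \<union> outer_set Y \<noteq> V \<Longrightarrow> tight (bi_inter D Y)"
proof -
  have D': "dangerous u D" using D by (rule max_dangerousD)
  have uu: "u \<in> inner_set D" "u \<in> inner_set Y" using dangerous_mem u D' Y by auto
  have aY: "a \<notin> inner_set Y" using dangerous_separate[OF u D Y a(1-3) b(1-3)] .
  have au: "a \<noteq> u" and bu: "b \<noteq> u" using a b uu by auto
  have bu': "tight_hull b \<noteq> tight_hull u"
    using hull_eq_iff[OF u b(1)] b(3) D' by (auto simp: dangerous_def bi_le_def)
  note fD = dangerous_facts[OF u D' a(1,2) au] and fY = dangerous_facts[OF u Y b(1,2) bu]
  show inter: "tight (bi_inter D Y)" if "outer_set D \<union> outer_set Y \<noteq> V"
    using dangerous_union[OF u D Y b(2,3) that] surplus_nonneg[of "bi_inter D Y"] fD(2) fY(2)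
    by (simp add: tight_def)
  have n1: "\<not> inner_set D \<subseteq> outer_set Y"
    using dangerous_not_subset[OF u D' Y a(1,2) aY a(3,4) b(1,2) bu inter] .
  have n2: "\<not> inner_set Y \<subseteq> outer_set D"
    using dangerous_not_subset[OF u Y D' b(1-3) bu' b(4) a(1,2) au] inter
    by (simp add: Un_commute bi_inter_def Int_commute)
  have p: "proper_biset V (bi_diff D Y)" "proper_biset V (bi_diff Y D)"
    using proper_diff fD(1) fY(1) n1 n2 by auto
  have sub: "inner_set D \<inter> outer_set Y \<subseteq> V" "inner_set Y \<inter> outer_set D \<subseteq> V"
    using proper_subset[OF fD(1)] proper_subset[OF fY(1)] by auto
  have "inner_set (tight_hull u) \<subseteq> inner_set D \<inter> outer_set Y" "inner_set (tight_hull u) \<subseteq> inner_set Y \<inter> outer_set D"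
    using D' Y proper_subset(1)[OF fD(1)] proper_subset(1)[OF fY(1)] unfolding dangerous_def bi_le_def by blast+
  then have ge: "wt (inner_set (tight_hull u)) \<le> wt (inner_set D \<inter> outer_set Y)"
    "wt (inner_set (tight_hull u)) \<le> wt (inner_set Y \<inter> outer_set D)"
    using wt_mono sub by blast+
  note le = surplus_diff[OF fD(1) fY(1)] surplus_nonneg[OF p(1)] surplus_nonneg[OF p(2)] hull_wt_pos[OF u] ge
    fD(2) fY(2)
  show "wt (inner_set (tight_hull u)) = 1" "wt (inner_set D \<inter> outer_set Y) = 1" "wt (inner_set Y \<inter> outer_set D) = 1"
    "biset_degree E (outer_set D \<union> outer_set Y, inner_set D \<inter> inner_set Y) = 0"
    using le by linarith+
  show "tight (bi_diff D Y)" using le p by (simp add: tight_def)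
  show "a \<in> inner_set D - outer_set Y"
  proof (rule ccontr)
    assume "\<not> ?thesis"
    then have "a \<in> inner_set D \<inter> outer_set Y" using a by blast
    moreover have "u \<in> inner_set D \<inter> outer_set Y" using uu proper_subset(1)[OF fY(1)] by blast
    ultimately have "2 \<le> wt (inner_set D \<inter> outer_set Y)"
      using wt_ge_2[OF a(1) u au _ _ sub(1)] by simp
    then show False using \<open>wt (inner_set D \<inter> outer_set Y) = 1\<close> by simp
  qed
qed

end

section \<open>Weight counts around hulls and dangerous bi-sets\<close>

context minimal_extension
begin

lemma wt_three_parts:
  assumes "proper_biset V X"
  shows "wt V = wt (inner_set X) + wt (wall X) + wt (V - outer_set X)"
proof -
  note s = proper_subset[OF assms]
  have "V \<inter> outer_set X = outer_set X" "outer_set X \<inter> inner_set X = inner_set X"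
    using s by blast+
  then show ?thesis
    using wt_split[of V "outer_set X"] wt_split[OF s(2), of "inner_set X"] by (simp add: wall_def)
qed

lemma hull_compl_ge: "u \<in> supp \<Longrightarrow> wt (inner_set (tight_hull u)) \<le> wt (V - outer_set (tight_hull u))"
  using wt_compl_ge[OF hull_proper, of u] hull_surplus[of u] by simp

text \<open>Otherwise all positive weight outside the hull of \<open>u\<close> lies in one hull,
  that of \<open>e\<close>, with wall \<open>{u}\<close>. Comparing inner sets with complements, the
  hull of \<open>u\<close> weighs at most as much as that of \<open>e\<close>, which weighs at most
  as much as the hull of \<open>u\<close> without \<open>u\<close>.\<close>

lemma ex_unrelated:
  assumes u: "u \<in> supp"
    and max: "\<And>v. v \<in> supp \<Longrightarrow> wt (inner_set (tight_hull v)) \<le> wt (inner_set (tight_hull u))"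
  shows "\<exists>a \<in> supp. tight_hull a \<noteq> tight_hull u \<and> \<not> wall_related u a"
proof (rule ccontr)
  assume none: "\<not> ?thesis"
  have rel: "wall_related u a" if "a \<in> supp" "tight_hull a \<noteq> tight_hull u" for a
    using none that by blast
  let ?I = "\<lambda>v. inner_set (tight_hull v)" and ?R = "\<lambda>v. V - outer_set (tight_hull v)"
  have "0 < wt (?R u)" using hull_compl_ge[OF u] hull_wt_pos[OF u] by linarith
  then obtain e where e: "e \<in> supp" "e \<in> ?R u" using wt_pos_obtain by (metis Diff_subset)
  have "e \<notin> ?I u" using e hull_subset(3)[OF u] by blast
  then have ne: "tight_hull e \<noteq> tight_hull u" using hull_eq_iff[OF u e(1)] by metis
  note re = rel[OF e(1) ne]
  have "wall (tight_hull u) \<noteq> {e}" using e by (auto simp: wall_def)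
  then have we: "wall (tight_hull e) = {u}" using re by (simp add: wall_related_def)
  have cls: "a \<in> ?I e" if a: "a \<in> supp" "a \<notin> ?I u" for a
  proof -
    have "tight_hull a \<noteq> tight_hull u" using a hull_eq_iff[OF u a(1)] by metis
    then have "tight_hull e = tight_hull a"
      using wall_related_class[OF u e(1) a(1) re] rel a by blast
    then show ?thesis using hull_eq_iff[OF e(1) a(1)] by blast
  qed
  have 1: "wt (?R u) \<le> wt (?I e)"
  proof (rule wt_mono_supp)
    show "?R u \<inter> supp \<subseteq> ?I e" using cls hull_subset(3)[OF u] by blast
  qed (use hull_subset(1)[OF e(1)] in auto)
  have 2: "wt (?R e) \<le> wt (?I u - {u})"
  proof (rule wt_mono_supp)
    have "u \<in> outer_set (tight_hull e)" using we unfolding wall_def by blast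
    then show "?R e \<inter> supp \<subseteq> ?I u - {u}" using cls hull_subset(3)[OF e(1)] by blast
  qed (use hull_subset(1)[OF u] in auto)
  have "?I u \<inter> {u} = {u}" using tight_hull(2)[OF u] by blast
  then have "wt (?I u) = wt {u} + wt (?I u - {u})"
    using wt_split[OF hull_subset(1)[OF u], of "{u}"] by simp
  moreover have "1 \<le> wt {u}" using wt_ge_1[OF u, of "{u}"] supp_V[OF u] by simp
  ultimately show False
    using 1 2 hull_compl_ge[OF u] hull_compl_ge[OF e(1)] by linarith
qed

text \<open>Each complement weighs at least as much as the inner set, so at most one unit is left
  for a wall; and by nesting, one of the two inner sets carries all its weight on the wall of the
  other hull.\<close>

lemma wall_between_halves:
  assumes x: "x \<in> supp" and t: "t \<in> supp" and w: "wall (tight_hull x) = {t}"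
    and r: "wt V \<le> 2 * wt (inner_set (tight_hull x)) + 1" "wt (inner_set (tight_hull t)) = wt (inner_set (tight_hull x))"
  shows "wt (inner_set (tight_hull x)) \<le> 1"
proof -
  let ?X = "tight_hull x" and ?Z = "tight_hull t"
  have pX: "proper_biset V ?X" and pZ: "proper_biset V ?Z" using hull_proper x t by auto
  have oX: "outer_set ?X = insert t (inner_set ?X)" "t \<notin> inner_set ?X"
    using w proper_subset(1)[OF pX] unfolding wall_def by blast+
  then have "tight_hull x \<noteq> tight_hull t" using hull_eq_iff[OF x t] by metis
  note disj = hull_disjoint[OF x t this]
  have d: "y \<notin> inner_set ?X \<inter> inner_set ?Z" if "y \<in> supp" for y
    using wt_ge_1[OF that, of "inner_set ?X \<inter> inner_set ?Z"] disj hull_subset(1)[OF x] by auto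
  have mt: "wt {t} \<le> 1"
    using wt_three_parts[OF pX] hull_compl_ge[OF x] r(1) unfolding w by linarith
  have t1: "wt (inner_set ?X) \<le> 1" if "inner_set ?Z \<subseteq> outer_set ?X"
  proof -
    have "wt (inner_set ?Z) \<le> wt {t}"
    proof (rule wt_mono_supp)
      show "inner_set ?Z \<inter> supp \<subseteq> {t}" using that oX d by blast
    qed (use hull_subset(1)[OF t] supp_V[OF t] in auto)
    then show ?thesis using mt r by linarith
  qed
  have p: "0 < wt (inner_set ?X)" using hull_wt_pos[OF x] by linarith
  from wall_of_wall_hull[OF tight_hull(1)[OF x] w p t disj] t1
  show ?thesis
  proof (elim disjE conjE bexE)
    fix z assume z: "z \<in> inner_set ?X" "wall ?Z = {z}" "inner_set ?X \<subseteq> outer_set ?Z"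
    have oZ: "outer_set ?Z = insert z (inner_set ?Z)"
      using z(2) proper_subset(1)[OF pZ] unfolding wall_def by blast
    have "wt (inner_set ?X) \<le> wt {z}"
    proof (rule wt_mono_supp)
      show "inner_set ?X \<inter> supp \<subseteq> {z}" using z(3) oZ d by blast
    qed (use hull_subset(1)[OF x] z in auto)
    moreover have "wt {z} \<le> 1"
      using wt_three_parts[OF pZ] hull_compl_ge[OF t] r unfolding z(2) by linarith
    ultimately show ?thesis by linarith
  qed
qed

end

context blocked_extension
begin

text \<open>Otherwise all positive weight outside the inner set of \<open>D\<close> lies in the hull
  of \<open>e\<close>, which weighs at most as much as that of \<open>u\<close>, and
  \<open>D\<close> exceeds the latter through \<open>a\<close>. With \<open>wt_compl_ge\<close> this
  leaves equality everywhere; the wall relation then forces hulls of weight one and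
  \<open>wt V = 3\<close>.\<close>

lemma ex_outside_dangerous:
  assumes u: "u \<in> supp" and V3: "wt V \<noteq> 3"
    and max: "\<And>v. v \<in> supp \<Longrightarrow> wt (inner_set (tight_hull v)) \<le> wt (inner_set (tight_hull u))"
    and D: "dangerous u D" and a: "a \<in> supp" "a \<in> inner_set D" "tight_hull a \<noteq> tight_hull u"
  shows "\<exists>b \<in> supp. b \<notin> inner_set D \<and> \<not> wall_related u b"
proof (rule ccontr)
  assume none: "\<not> ?thesis"
  have rel: "wall_related u b" if "b \<in> supp" "b \<notin> inner_set D" for b
    using none that by blast
  let ?I = "\<lambda>v. inner_set (tight_hull v)" and ?R = "V - outer_set D"
  have pD: "proper_biset V D" "surplus D \<le> 1" and le: "bi_le (tight_hull u) D"
    using D by (auto simp: dangerous_def)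
  note s = proper_subset[OF pD(1)]
  have c: "wt (inner_set D) - 1 \<le> wt ?R" using wt_compl_ge[OF pD(1)] pD(2) by linarith
  have anu: "a \<notin> ?I u" using a hull_eq_iff[OF u a(1)] by metis
  have "inner_set D \<inter> ?I u = ?I u" using le by (auto simp: bi_le_def)
  then have "wt (inner_set D) = wt (?I u) + wt (inner_set D - ?I u)"
    using wt_split[OF s(3), of "?I u"] by simp
  moreover have "1 \<le> wt (inner_set D - ?I u)"
    using wt_ge_1[OF a(1), of "inner_set D - ?I u"] a(2) anu s(3) by blast
  ultimately have D1: "wt (?I u) + 1 \<le> wt (inner_set D)" by linarith
  then have "0 < wt ?R" using c hull_wt_pos[OF u] by linarith
  then obtain e where e: "e \<in> supp" "e \<in> ?R" using wt_pos_obtain by (metis Diff_subset)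
  have re: "wall_related u e" using rel[OF e(1)] e(2) s(1) by blast
  have cls: "b \<in> ?I e" if b: "b \<in> supp" "b \<notin> inner_set D" for b
  proof -
    have "tight_hull e = tight_hull b"
      using wall_related_class[OF u e(1) b(1) re] rel[OF b] by blast
    then show ?thesis using hull_eq_iff[OF e(1) b(1)] by blast
  qed
  have 1: "wt ?R \<le> wt (V - inner_set D)" using s by (intro wt_mono) auto
  have 2: "wt (V - inner_set D) \<le> wt (?I e)"
  proof (rule wt_mono_supp)
    show "(V - inner_set D) \<inter> supp \<subseteq> ?I e" using cls by blast
  qed (use hull_subset(1)[OF e(1)] in auto)
  have "V \<inter> inner_set D = inner_set D" using s by blast
  then have V: "wt V = wt (inner_set D) + wt (V - inner_set D)"
    using wt_split[of V "inner_set D"] by simp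
  have eq: "wt (?I e) = wt (?I u)" "wt V = 2 * wt (?I u) + 1"
    using max[OF e(1)] 1 2 V D1 c by linarith+
  from re have "wt (?I u) \<le> 1"
    unfolding wall_related_def
  proof
    assume "wall (tight_hull u) = {e}"
    moreover have "wt V \<le> 2 * wt (?I u) + 1" using eq(2) by linarith
    ultimately show ?thesis using eq(1) by (rule wall_between_halves[OF u e(1)])
  next
    assume "wall (tight_hull e) = {u}"
    moreover have "wt V \<le> 2 * wt (?I e) + 1" using eq by linarith
    ultimately have "wt (?I e) \<le> 1" using eq(1)[symmetric] by (rule wall_between_halves[OF e(1) u])
    then show ?thesis using eq(1) by linarith
  qed
  then show False using V3 eq hull_wt_pos[OF u] by linarith
qed

lemma biset_degree_0D: "biset_degree E X = 0 \<Longrightarrow> e \<in># E \<Longrightarrow> \<not> enters e X"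
  by (auto simp: biset_degree_def)

text \<open>Equality in \<open>dangerous_pair\<close> pushes all hull weights down to one. Then each
  vertex of \<open>supp\<close> has exactly two unrelated partners and at most one related one, so
  only tiny configurations remain.\<close>

lemma blocked_contradiction:
  assumes V2: "2 \<le> wt V" and V3: "wt V \<noteq> 3"
  shows False
proof -
  let ?I = "\<lambda>v. inner_set (tight_hull v)"
  have "supp \<noteq> {}" using V2 wt_inter_supp[of V] by auto
  then have "Max ((\<lambda>v. wt (?I v)) ` supp) \<in> (\<lambda>v. wt (?I v)) ` supp"
    using finite_supp by (intro Max_in) auto
  then obtain u where u: "u \<in> supp" and eq: "Max ((\<lambda>v. wt (?I v)) ` supp) = wt (?I u)"
    by blast
  have umax: "wt (?I v) \<le> wt (?I u)" if "v \<in> supp" for v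
    unfolding eq[symmetric] using finite_supp that by (intro Max_ge) auto
  \<comment> \<open>As \<open>u\<close> has the heaviest hull, weight one here bounds all
    hulls.\<close>
  have hull_u: "wt (?I u) = 1"
  proof -
    obtain a where a: "a \<in> supp" "tight_hull a \<noteq> tight_hull u" "\<not> wall_related u a"
      using ex_unrelated[OF u umax] by blast
    obtain D where D: "max_dangerous u D" "bi_le (tight_hull a) D"
      using ex_max_dangerous[OF u a(1) a(2)[symmetric] a(3)] by blast
    have aD: "a \<in> inner_set D" using D(2) tight_hull(2)[OF a(1)] by (auto simp: bi_le_def)
    note Dd = max_dangerousD[OF D(1)]
    obtain b where b: "b \<in> supp" "b \<notin> inner_set D" "\<not> wall_related u b"
      using ex_outside_dangerous[OF u V3 umax Dd a(1) aD a(2)] by blast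
    have "b \<notin> ?I u" using Dd b(2) by (auto simp: dangerous_def bi_le_def)
    then have "tight_hull u \<noteq> tight_hull b" using hull_eq_iff[OF u b(1)] by metis
    then obtain Y where Y: "max_dangerous u Y" "bi_le (tight_hull b) Y"
      using ex_max_dangerous[OF u b(1) _ b(3)] by blast
    have bY: "b \<in> inner_set Y" using Y(2) tight_hull(2)[OF b(1)] by (auto simp: bi_le_def)
    show ?thesis
      using dangerous_pair(1)[OF u D(1) max_dangerousD[OF Y(1)] a(1) aD a(2,3) b(1) bY b(2,3)] .
  qed
  have hull1: "wt (?I v) = 1" if "v \<in> supp" for v
    using umax[OF that] hull_wt_pos[OF that] hull_u by linarith
  then have hmax: "wt (?I v) \<le> wt (?I x)" if "x \<in> supp" "v \<in> supp" for x v
    using that by simp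
  have inj: "v = w" if vw: "v \<in> supp" "w \<in> supp" "w \<in> ?I v" for v w
    using wt_ge_2[OF vw(1,2) _ tight_hull(2)[OF vw(1)] vw(3) hull_subset(1)[OF vw(1)]] hull1[OF vw(1)]
    by linarith
  have inj': "tight_hull v \<noteq> tight_hull w" if "v \<in> supp" "w \<in> supp" "v \<noteq> w" for v w
    using inj[OF that(1,2)] hull_eq_iff[OF that(1,2)] that(3) by blast
  \<comment> \<open>The part of \<open>D\<close> outside \<open>Y\<close> is tight around
    \<open>a\<close>, hence inside its hull, where \<open>a\<close> is the only vertex of
    \<open>supp\<close>; the overlap with \<open>Y\<close> has weight one, spent on
    \<open>x\<close>.\<close>
  have two: "\<exists>D. max_dangerous x D \<and> bi_le (tight_hull a) D \<and> inner_set D \<inter> supp = {x, a}"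
    if x: "x \<in> supp" and a: "a \<in> supp" "a \<noteq> x" "\<not> wall_related x a" for x a
  proof -
    obtain D where D: "max_dangerous x D" "bi_le (tight_hull a) D"
      using ex_max_dangerous[OF x a(1) inj'[OF x a(1) a(2)[symmetric]] a(3)] by blast
    note Dd = max_dangerousD[OF D(1)]
    have aD: "a \<in> inner_set D" using D(2) tight_hull(2)[OF a(1)] by (auto simp: bi_le_def)
    have xD: "x \<in> inner_set D" using dangerous_mem[OF x Dd] .
    obtain b where b: "b \<in> supp" "b \<notin> inner_set D" "\<not> wall_related x b"
      using ex_outside_dangerous[OF x V3 hmax[OF x] Dd a(1) aD inj'[OF a(1) x a(2)]] by blast
    have "x \<noteq> b" using xD b by blast
    then obtain Y where Y: "max_dangerous x Y" "bi_le (tight_hull b) Y"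
      using ex_max_dangerous[OF x b(1) inj'[OF x b(1)] b(3)] by blast
    have bY: "b \<in> inner_set Y" using Y(2) tight_hull(2)[OF b(1)] by (auto simp: bi_le_def)
    note Yd = max_dangerousD[OF Y(1)]
    note pr = dangerous_pair[OF x D(1) Yd a(1) aD inj'[OF a(1) x a(2)] a(3) b(1) bY b(2,3)]
    have sub: "inner_set D \<subseteq> V" "inner_set Y \<subseteq> outer_set Y"
      using Dd Yd proper_subset(1,3) unfolding dangerous_def by blast+
    have "y = x \<or> y = a" if y: "y \<in> inner_set D" "y \<in> supp" for y
    proof (cases "y \<in> outer_set Y")
      case True
      then have "y = x"
        using wt_ge_2[OF y(2) x, of "inner_set D \<inter> outer_set Y"] y xD dangerous_mem[OF x Yd] sub pr(2)
        by fastforce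
      then show ?thesis ..
    next
      case False
      have "bi_le (bi_diff D Y) (tight_hull a)" using tight_hull_max[OF a(1) pr(4)] pr(5) by simp
      then have "y \<in> ?I a" using False y by (auto simp: bi_le_def)
      then show ?thesis using inj[OF a(1) y(2)] by blast
    qed
    then have "inner_set D \<inter> supp = {x, a}" using aD xD a(1) x by blast
    then show ?thesis using D by blast
  qed
  \<comment> \<open>The outer sets of three dangerous bi-sets around \<open>x\<close> meet pairwise
    inside that of the hull of \<open>x\<close>. A vertex beyond it is missing from two of them, so
    \<open>dangerous_pair\<close> forbids an edge to it from the inner set of the hull.\<close>
  have no_three: False
    if x: "x \<in> supp" and a: "a \<in> supp" "a \<noteq> x" "\<not> wall_related x a"
      and b: "b \<in> supp" "b \<noteq> x" "\<not> wall_related x b"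
      and c: "c \<in> supp" "c \<noteq> x" "\<not> wall_related x c" and ne: "a \<noteq> b" "a \<noteq> c" "b \<noteq> c" for x a b c
  proof -
    obtain D where D: "max_dangerous x D" "bi_le (tight_hull a) D" "inner_set D \<inter> supp = {x, a}"
      using two[OF x a] by blast
    obtain Y where Y: "max_dangerous x Y" "bi_le (tight_hull b) Y" "inner_set Y \<inter> supp = {x, b}"
      using two[OF x b] by blast
    obtain Z where Z: "max_dangerous x Z" "bi_le (tight_hull c) Z" "inner_set Z \<inter> supp = {x, c}"
      using two[OF x c] by blast
    note d = max_dangerousD[OF D(1)] max_dangerousD[OF Y(1)] max_dangerousD[OF Z(1)]
    have mem: "a \<in> inner_set D" "b \<in> inner_set Y" "c \<in> inner_set Z"
      and nmem: "b \<notin> inner_set D" "c \<notin> inner_set D" "c \<notin> inner_set Y"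
      using D(3) Y(3) Z(3) a(1) b c ne by blast+
    note DY = dangerous_pair[OF x D(1) d(2) a(1) mem(1) inj'[OF a(1) x a(2)] a(3) b(1) mem(2) nmem(1) b(3)]
    note DZ = dangerous_pair[OF x D(1) d(3) a(1) mem(1) inj'[OF a(1) x a(2)] a(3) c(1) mem(3) nmem(2) c(3)]
    note YZ = dangerous_pair[OF x Y(1) d(3) b(1) mem(2) inj'[OF b(1) x b(2)] b(3) c(1) mem(3) nmem(3) c(3)]
    have sub: "inner_set D \<subseteq> outer_set D" "inner_set Y \<subseteq> outer_set Y" "inner_set Z \<subseteq> outer_set Z"
      "inner_set D \<subseteq> V" "inner_set Y \<subseteq> V" "inner_set Z \<subseteq> V"
      using d proper_subset(1,3) unfolding dangerous_def by blast+
    have xx: "x \<in> inner_set D" "x \<in> inner_set Y" "x \<in> inner_set Z"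
      using dangerous_mem[OF x] d by auto
    have single: "y \<notin> outer_set B" if "wt (inner_set A \<inter> outer_set B) = 1" "y \<in> supp" "y \<noteq> x"
      "y \<in> inner_set A" "x \<in> inner_set A" "x \<in> outer_set B" "inner_set A \<subseteq> V" for A B :: "'a biset" and y
    proof
      assume "y \<in> outer_set B"
      then have "2 \<le> wt (inner_set A \<inter> outer_set B)"
        using wt_ge_2[OF that(2) x that(3), of "inner_set A \<inter> outer_set B"] that(4-7) by fast
      then show False using that(1) by simp
    qed
    have "c \<notin> outer_set D" "c \<notin> outer_set Y" "b \<notin> outer_set D" "b \<notin> outer_set Z" "a \<notin> outer_set Y" "a \<notin> outer_set Z"
      using single[OF DZ(3) c(1,2)] single[OF YZ(3) c(1,2)] single[OF DY(3) b(1,2)] single[OF YZ(2) b(1,2)]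
        single[OF DY(2) a(1,2)] single[OF DZ(2) a(1,2)] mem xx sub by blast+
    then have "outer_set D \<union> outer_set Y \<noteq> V" "outer_set D \<union> outer_set Z \<noteq> V" "outer_set Y \<union> outer_set Z \<noteq> V"
      using supp_V[OF a(1)] supp_V[OF b(1)] supp_V[OF c(1)] by blast+
    then have "tight (bi_inter D Y)" "tight (bi_inter D Z)" "tight (bi_inter Y Z)"
      using DY(7) DZ(7) YZ(7) by blast+
    then have "bi_le (bi_inter D Y) (tight_hull x)" "bi_le (bi_inter D Z) (tight_hull x)" "bi_le (bi_inter Y Z) (tight_hull x)"
      using tight_hull_max[OF x] xx by simp_all
    then have o: "outer_set D \<inter> outer_set Y \<subseteq> outer_set (tight_hull x)"
      "outer_set D \<inter> outer_set Z \<subseteq> outer_set (tight_hull x)"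
      "outer_set Y \<inter> outer_set Z \<subseteq> outer_set (tight_hull x)"
      unfolding bi_le_def bi_simps by blast+
    have i: "?I x \<subseteq> inner_set D" "?I x \<subseteq> inner_set Y" "?I x \<subseteq> inner_set Z"
      using d unfolding dangerous_def bi_le_def by blast+
    have "\<not> enters e (tight_hull x)" if e: "e \<in># E" for e
    proof
      assume "enters e (tight_hull x)"
      then obtain p q where pq: "e = Upair p q" "p \<in> ?I x" "q \<notin> outer_set (tight_hull x)"
        unfolding enters_def by blast
      consider "q \<notin> outer_set D" "q \<notin> outer_set Y" | "q \<notin> outer_set D" "q \<notin> outer_set Z" | "q \<notin> outer_set Y" "q \<notin> outer_set Z"
        using o pq(3) by blast
      then show False
      proof cases
        case 1
        then show False using biset_degree_0D[OF DY(6) e] pq(1,2) i by auto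
      next
        case 2
        then show False using biset_degree_0D[OF DZ(6) e] pq(1,2) i by auto
      next
        case 3
        then show False using biset_degree_0D[OF YZ(6) e] pq(1,2) i by auto
      qed
    qed
    then have "biset_degree E (tight_hull x) = 0" by (simp add: biset_degree_def)
    \<comment> \<open>With degree zero and weight one, the wall has to supply
      \<open>2 * k - 1\<close>, but it supplies at most \<open>k\<close>.\<close>
    then have "2 * int k - 1 = int k * int (card (wall (tight_hull x)))"
      using degree_eq_surplus[of "tight_hull x"] hull_surplus[OF x] hull1[OF x] by simp
    moreover have "int k * int (card (wall (tight_hull x))) \<le> int k * 1"
      using hull_wall[OF x] by (intro mult_left_mono) auto
    ultimately show False using k_ge_2 by linarith
  qed
  have ex_two: "\<exists>a b. a \<in> supp \<and> b \<in> supp \<and> a \<noteq> x \<and> b \<noteq> x \<and> a \<noteq> b \<and> \<not> wall_related x a \<and> \<not> wall_related x b"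
    if x: "x \<in> supp" for x
  proof -
    obtain a where a: "a \<in> supp" "tight_hull a \<noteq> tight_hull x" "\<not> wall_related x a"
      using ex_unrelated[OF x hmax[OF x]] by blast
    then have ax: "a \<noteq> x" by blast
    obtain D where D: "max_dangerous x D" "inner_set D \<inter> supp = {x, a}"
      using two[OF x a(1) ax a(3)] by blast
    have aD: "a \<in> inner_set D" using D(2) by blast
    obtain b where b: "b \<in> supp" "b \<notin> inner_set D" "\<not> wall_related x b"
      using ex_outside_dangerous[OF x V3 hmax[OF x] max_dangerousD[OF D(1)] a(1) aD a(2)] by blast
    then have "b \<noteq> x" "b \<noteq> a" using D(2) by blast+
    then show ?thesis using a b ax by blast
  qed
  have m1: "m v = 1" if "v \<in> supp" for v
    using wt_ge_member[OF tight_hull(2)[OF that] hull_subset(1)[OF that]] hull1[OF that] that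
    by (simp add: supp_def)
  \<comment> \<open>Without a related vertex, \<open>u\<close> and its two unrelated partners are
    all of \<open>supp\<close>, of total weight three.\<close>
  have "\<exists>e \<in> supp. wall_related u e"
  proof (rule ccontr)
    assume none: "\<not> ?thesis"
    obtain a b where ab: "a \<in> supp" "b \<in> supp" "a \<noteq> u" "b \<noteq> u" "a \<noteq> b"
      using ex_two[OF u] by blast
    have "supp \<subseteq> {u, a, b}"
      using no_three[OF u, of a b] ab none by blast
    then have "supp = {u, a, b}" using ab u by blast
    then have "wt supp = 3" using ab m1 by (simp add: wt_def)
    moreover have "V \<inter> supp = supp" by (auto simp: supp_def)
    ultimately show False using wt_inter_supp[of V] V3 by simp
  qed
  then obtain p t where p: "p \<in> supp" and t: "t \<in> supp" and w: "wall (tight_hull p) = {t}"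
    using u unfolding wall_related_def by blast
  have pt: "wall_related p t" "wall_related t p" using w by (auto simp: wall_related_def)
  obtain a where a: "a \<in> supp" "a \<noteq> p" "\<not> wall_related p a" using ex_two[OF p] by blast
  have at: "a \<noteq> t" using a pt by blast
  \<comment> \<open>All vertices related to \<open>t\<close> share the hull of \<open>p\<close>,
    which now has a single vertex of \<open>supp\<close>.\<close>
  have "\<not> wall_related t a"
    using wall_related_class[OF t a(1) p _ pt(2)] inj'[OF a(1) p a(2)] by blast
  then have ta: "\<not> wall_related a t" "\<not> wall_related a p" using a wall_related_commute by blast+
  obtain D where D: "max_dangerous a D" "bi_le (tight_hull p) D" "inner_set D \<inter> supp = {a, p}"
    using two[OF a(1) p a(2)[symmetric] ta(2)] by blast
  obtain Y where Y: "max_dangerous a Y" "inner_set Y \<inter> supp = {a, t}"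
    using two[OF a(1) t at[symmetric] ta(1)] by blast
  have tp: "t \<noteq> p" using w tight_hull(2)[OF p] unfolding wall_def by blast
  have mem: "p \<in> inner_set D" "t \<in> inner_set Y" "t \<notin> inner_set D" "a \<in> inner_set D" "a \<in> inner_set Y"
  proof -
    show "t \<notin> inner_set D" using D(3) t tp at by (metis IntI insertE singletonD)
  qed (use D(3) Y(2) in blast)+
  have one: "wt (inner_set Y \<inter> outer_set D) = 1"
    using dangerous_pair(3)[OF a(1) D(1) max_dangerousD[OF Y(1)] p mem(1) inj'[OF p a(1) a(2)[symmetric]] ta(2)
      t mem(2,3) ta(1)] .
  \<comment> \<open>\<open>D\<close> contains the hull of \<open>p\<close> together with its wall
    vertex \<open>t\<close>; so \<open>t\<close> joins \<open>a\<close> in an overlap of weight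
    one.\<close>
  have "t \<in> outer_set D" using w D(2) unfolding wall_def bi_le_def by blast
  moreover have "a \<in> outer_set D" "inner_set Y \<subseteq> V"
    using mem max_dangerousD[OF D(1)] max_dangerousD[OF Y(1)] proper_subset(1,3) unfolding dangerous_def by blast+
  ultimately have "2 \<le> wt (inner_set Y \<inter> outer_set D)"
    using wt_ge_2[OF a(1) t at, of "inner_set Y \<inter> outer_set D"] mem by fast
  then show False using one by simp
qed

end

section \<open>Splitting off and the min-max formula\<close>

lemma minimal_extensionI:
  assumes "extension V E k m"
    and "\<And>v. v \<in> V \<Longrightarrow> 0 < m v \<Longrightarrow>
      \<exists>X. proper_biset V X \<and> v \<in> inner_set X \<and> f_biset k E X + sum m (inner_set X) = 2 * k"
  shows "minimal_extension V E k m"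
proof -
  interpret extension V E k m by fact
  show ?thesis
  proof
    fix v assume "v \<in> V" "0 < m v"
    then obtain X where X: "proper_biset V X" "v \<in> inner_set X" "f_biset k E X + sum m (inner_set X) = 2 * k"
      using assms(2) by blast
    then have "surplus X = 0" unfolding surplus_def wt_def by linarith
    then show "\<exists>X. tight X \<and> v \<in> inner_set X" using X tight_def by blast
  qed
qed

lemma sum_decrease:
  fixes m :: "'a \<Rightarrow> nat"
  assumes "finite S" "0 < m u"
  shows "sum (m(u := m u - 1)) S + of_bool (u \<in> S) = sum m S"
proof (cases "u \<in> S")
  case True
  then have "sum (m(u := m u - 1)) S = (m u - 1) + sum (m(u := m u - 1)) (S - {u})"
    using assms by (subst sum.remove[of S u]) auto
  moreover have "sum m S = m u + sum m (S - {u})"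
    using assms True by (simp add: sum.remove)
  moreover have "sum (m(u := m u - 1)) (S - {u}) = sum m (S - {u})"
    by (rule sum.cong) auto
  ultimately show ?thesis using assms True by simp
next
  case False
  then have "sum (m(u := m u - 1)) S = sum m S" by (intro sum.cong) auto
  then show ?thesis using False by simp
qed

lemma ex_minimal_extension:
  assumes "multigraph V E" "2 \<le> k"
  shows "\<exists>m. minimal_extension V E k m"
proof -
  have fin: "finite V" using assms by (simp add: multigraph_def)
  \<comment> \<open>Inner sets of proper bi-sets are non-empty, so one vertex of weight
    \<open>2 * k\<close> meets any demand.\<close>
  have "extension V E k (\<lambda>_. 2 * k)"
  proof
    fix X assume X: "proper_biset V X"
    then have "finite (inner_set X)" "inner_set X \<noteq> {}"
      using finite_biset(2)[OF fin, of X] by (simp_all add: proper_biset_iff is_biset_def psubset_eq)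
    then have "1 \<le> card (inner_set X)" by (simp add: Suc_le_eq card_gt_0_iff)
    then have "1 * (2 * k) \<le> card (inner_set X) * (2 * k)" by (rule mult_le_mono1)
    moreover have "(\<Sum>_\<in>inner_set X. 2 * k) = card (inner_set X) * (2 * k)" by simp
    ultimately show "2 * k \<le> f_biset k E X + (\<Sum>_\<in>inner_set X. 2 * k)" by linarith
  qed (use assms in auto)
  from ex_has_least_nat[of "extension V E k", OF this, of "\<lambda>m. sum m V"]
  obtain m where m: "extension V E k m" "\<And>m'. extension V E k m' \<Longrightarrow> sum m V \<le> sum m' V"
    by blast
  have "minimal_extension V E k m"
  proof (rule minimal_extensionI[OF m(1)])
    fix v assume v: "v \<in> V" "0 < m v"
    let ?m = "m(v := m v - 1)"
    have "sum ?m V < sum m V" using sum_decrease[of V m v] fin v by simp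
    then have "\<not> extension V E k ?m" using m(2)[of ?m] by linarith
    \<comment> \<open>A bi-set violated after lowering \<open>m v\<close> by one contains
      \<open>v\<close> and was met exactly before: the tight witness.\<close>
    then obtain X where X: "proper_biset V X" "f_biset k E X + sum ?m (inner_set X) < 2 * k"
      using assms unfolding extension_def by (auto simp: not_le)
    have "sum ?m (inner_set X) + of_bool (v \<in> inner_set X) = sum m (inner_set X)"
      using extension.proper_finite(2)[OF m(1) X(1)] v(2) by (rule sum_decrease)
    moreover have "2 * k \<le> f_biset k E X + sum m (inner_set X)"
      using extension.covers[OF m(1) X(1)] .
    ultimately have "v \<in> inner_set X" "f_biset k E X + sum m (inner_set X) = 2 * k"
      using X(2) by (cases "v \<in> inner_set X"; simp)+
    then show "\<exists>X. proper_biset V X \<and> v \<in> inner_set X \<and> f_biset k E X + sum m (inner_set X) = 2 * k"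
      using X(1) by blast
  qed
  then show ?thesis by blast
qed

section \<open>One splitting step and the exceptional weight three\<close>

context minimal_extension
begin

lemma wall_hull_of_tight:
  assumes "tight X" "a \<in> supp" "a \<in> inner_set X" "y \<in> outer_set X" "y \<notin> inner_set (tight_hull a)"
  shows "wall (tight_hull a) = {y}"
proof -
  have "y \<in> wall (tight_hull a)"
    using tight_hull_max[OF assms(2,1,3)] assms(4,5) unfolding bi_le_def wall_def by blast
  then show ?thesis
    using wall_cases[OF hull_proper[OF assms(2)] hull_wall[OF assms(2)]] by (metis empty_iff singletonD)
qed

text \<open>A bi-set loses one unit for each of \<open>u\<close>, \<open>v\<close> inside it and
  gains one if the new edge enters. A tight bi-set around \<open>u\<close> has \<open>v\<close>
  outside its outer set, for otherwise \<open>v\<close> would lie in the hull of \<open>u\<close> or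
  be its wall; there loss and gain cancel, so tight witnesses stay tight.\<close>

lemma split:
  assumes u: "u \<in> supp" and v: "v \<in> supp" and ne: "tight_hull u \<noteq> tight_hull v"
    and rel: "\<not> wall_related u v"
    and safe: "\<And>D. proper_biset V D \<Longrightarrow> u \<in> inner_set D \<Longrightarrow> v \<in> inner_set D \<Longrightarrow> 1 < surplus D"
  shows "minimal_extension V (add_mset (Upair u v) E) k (m(u := m u - 1, v := m v - 1))"
    (is "minimal_extension V ?E k ?m")
proof -
  have uv: "u \<noteq> v" "0 < m u" "0 < m v" "u \<in> V" "v \<in> V" using ne u v by (auto simp: supp_def)
  have nm: "v \<notin> inner_set (tight_hull u)" "u \<notin> inner_set (tight_hull v)"
    using ne hull_eq_iff[OF u v] hull_eq_iff[OF v u] by auto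
  define c where "c X = f_biset k ?E X + sum ?m (inner_set X)" for X
  have new: "int (c X) - 2 * int k + int (of_bool (u \<in> inner_set X)) + int (of_bool (v \<in> inner_set X))
      = surplus X + int (of_bool (enters (Upair u v) X))" if X: "proper_biset V X" for X
  proof -
    note fin = proper_finite(2)[OF X]
    have "sum ?m (inner_set X) + of_bool (v \<in> inner_set X) = sum (m(u := m u - 1)) (inner_set X)"
      using sum_decrease[OF fin, of "m(u := m u - 1)" v] uv by simp
    then have "sum ?m (inner_set X) + of_bool (v \<in> inner_set X) + of_bool (u \<in> inner_set X) = sum m (inner_set X)"
      using sum_decrease[OF fin, of m u] uv by linarith
    moreover have "f_biset k ?E X = f_biset k E X + of_bool (enters (Upair u v) X)"
      unfolding f_biset_def biset_degree_add_mset by linarith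
    ultimately show ?thesis unfolding surplus_def wt_def c_def by linarith
  qed
  have tight_u: "v \<notin> outer_set X" if "tight X" "u \<in> inner_set X" for X
    using wall_hull_of_tight[OF that(1) u that(2) _ nm(1)] rel by (auto simp: wall_related_def)
  have tight_v: "u \<notin> outer_set X" if "tight X" "v \<in> inner_set X" for X
    using wall_hull_of_tight[OF that(1) v that(2) _ nm(2)] rel by (auto simp: wall_related_def)
  have cover: "2 * k \<le> c X" if X: "proper_biset V X" for X
  proof -
    note n = new[OF X] and pos = surplus_nonneg[OF X] and sub = proper_subset(1)[OF X]
    have pos1: "1 \<le> surplus X" if "\<not> tight X" using that pos X by (auto simp: tight_def)
    consider "u \<in> inner_set X" "v \<in> inner_set X" | "u \<in> inner_set X" "v \<notin> inner_set X"
      | "u \<notin> inner_set X" "v \<in> inner_set X" | "u \<notin> inner_set X" "v \<notin> inner_set X" by blast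
    then show ?thesis
    proof cases
      case 1
      then show ?thesis using n safe[OF X] by (simp add: of_bool_def split: if_splits)
    next
      case 2
      show ?thesis
      proof (cases "v \<in> outer_set X")
        case True
        then have "\<not> tight X" using tight_u[of X] 2 by blast
        then show ?thesis using n pos1 2 True by simp
      next
        case False
        then show ?thesis using n pos 2 by simp
      qed
    next
      case 3
      show ?thesis
      proof (cases "u \<in> outer_set X")
        case True
        then have "\<not> tight X" using tight_v[of X] 3 by blast
        then show ?thesis using n pos1 3 True by simp
      next
        case False
        then show ?thesis using n pos 3 by simp
      qed
    next
      case 4
      then show ?thesis using n pos by simp
    qed
  qed
  show ?thesis
  proof (rule minimal_extensionI)
    show "extension V ?E k ?m"
      using multigraph k_ge_2 cover uv by (auto simp: extension_def multigraph_def c_def)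
    fix x assume x: "x \<in> V" "0 < ?m x"
    then have "0 < m x" by (auto split: if_splits)
    then obtain X where X: "tight X" "x \<in> inner_set X" using tight_at x by blast
    have "inner_set X \<subseteq> outer_set X" using proper_subset(1)[OF tight_proper[OF X(1)]] .
    then have "of_bool (u \<in> inner_set X) + of_bool (v \<in> inner_set X) = (of_bool (enters (Upair u v) X) :: nat)"
      using tight_u[OF X(1)] tight_v[OF X(1)] by auto
    then have "c X = 2 * k"
      using new[OF tight_proper[OF X(1)]] X(1) unfolding tight_def by linarith
    then have "f_biset k ?E X + sum ?m (inner_set X) = 2 * k" by (simp only: c_def)
    then show "\<exists>X. proper_biset V X \<and> x \<in> inner_set X \<and> f_biset k ?E X + sum ?m (inner_set X) = 2 * k"
      using X tight_proper by blast
  qed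
qed

text \<open>
  Here all deficiencies are at most one, and a bi-set that the path misses has the middle vertex
  as its wall and is tight together with its complement, against \<open>common_wall\<close>.
\<close>

lemma path_covers:
  assumes V3: "wt V = 3"
  obtains x y z where "x \<in> V" "y \<in> V" "z \<in> V"
    "\<And>X. proper_biset V X \<Longrightarrow> 2 * k \<le> f_biset k (E + {#Upair x y, Upair y z#}) X"
proof -
  \<comment> \<open>A hull weighs no more than its complement, and both fit into three.\<close>
  have hull1: "wt (inner_set (tight_hull v)) = 1" if "v \<in> supp" for v
    using wt_three_parts[OF hull_proper[OF that]] hull_compl_ge[OF that] hull_wt_pos[OF that] V3
      wt_nonneg[of "wall (tight_hull v)"] by linarith
  have m1: "m v = 1" if "v \<in> supp" for v
    using wt_ge_member[OF tight_hull(2)[OF that] hull_subset(1)[OF that]] hull1[OF that] that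
    by (simp add: supp_def)
  have inj: "w \<notin> inner_set (tight_hull v)" if vw: "v \<in> supp" "w \<in> supp" "v \<noteq> w" for v w
    using wt_ge_2[OF vw tight_hull(2)[OF vw(1)] _ hull_subset(1)[OF vw(1)]] hull1[OF vw(1)]
    by linarith
  have "V \<inter> supp = supp" by (auto simp: supp_def)
  then have "wt supp = 3" using wt_inter_supp[of V] V3 by simp
  moreover have "wt supp = int (card supp)" using m1 by (simp add: wt_def)
  ultimately have "card supp = 3" by simp
  then obtain x y z where xyz: "supp = {x, y, z}" "x \<noteq> y" "y \<noteq> z" "x \<noteq> z"
    by (auto simp: card_3_iff)
  have V: "x \<in> V" "y \<in> V" "z \<in> V" using xyz(1) supp_V by auto
  have "2 * k \<le> f_biset k (E + {#Upair x y, Upair y z#}) X" if X: "proper_biset V X" for X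
  proof (rule ccontr)
    assume neg: "\<not> ?thesis"
    let ?I = "inner_set X" and ?R = "V - outer_set X"
    note s = proper_subset[OF X]
    have f: "f_biset k (E + {#Upair x y, Upair y z#}) X
        = f_biset k E X + of_bool (enters (Upair x y) X) + of_bool (enters (Upair y z) X)"
      unfolding f_biset_def by simp
    have cov: "2 * int k - int (f_biset k E X) \<le> wt ?I" "2 * int k - int (f_biset k E X) \<le> wt ?R"
      using covers_int[OF X] wt_compl_ge[OF X] unfolding surplus_def by linarith+
    have parts: "3 = wt ?I + wt (wall X) + wt ?R" using wt_three_parts[OF X] V3 by simp
    have def1: "1 \<le> 2 * int k - int (f_biset k E X)" using neg f by linarith
    then have "0 < wt ?I" "0 < wt ?R" using cov by linarith+
    then obtain a b where a: "a \<in> supp" "a \<in> ?I" and b: "b \<in> supp" "b \<in> ?R"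
      using wt_pos_obtain[of ?I] wt_pos_obtain[of ?R] s(3) by (metis Diff_subset)
    \<comment> \<open>The inner set and the complement both weigh at least the deficiency; two units
      each would exceed three.\<close>
    have "2 * int k - int (f_biset k E X) = 1"
      using def1 cov parts wt_nonneg[of "wall X"] by linarith
    then have noent: "\<not> enters (Upair x y) X" "\<not> enters (Upair y z) X"
      using neg f by (auto simp: of_bool_def split: if_splits)
    \<comment> \<open>Otherwise \<open>y\<close> is on one side, the opposite side contains
      \<open>x\<close> or \<open>z\<close>, and the path edge between them enters
      \<open>X\<close>.\<close>
    have y: "y \<in> wall X"
    proof (rule ccontr)
      assume "y \<notin> wall X"
      then have "y \<in> ?I \<or> y \<in> ?R" using V by (auto simp: wall_def)
      moreover have "a = x \<or> a = y \<or> a = z" "b = x \<or> b = y \<or> b = z"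
        using a(1) b(1) xyz(1) by auto
      ultimately show False
        using noent a(2) b(2) s(1) unfolding enters_Upair by (metis DiffD2 subsetD)
    qed
    then have "1 \<le> wt (wall X)"
      using wt_ge_1[of y "wall X"] xyz(1) s(2) by (auto simp: wall_def)
    \<comment> \<open>The three units are now one inside, one on the wall and one outside, matching
      the deficiency on both sides.\<close>
    then have eq: "surplus X = 0" "surplus (bi_compl V X) = 0"
      using def1 cov parts edges_in_V X f_biset_compl[OF edges_in_V, of X k]
      by (auto simp: surplus_def proper_biset_def)
    have T: "tight X" "tight (bi_compl V X)"
      using eq X proper_compl[OF X] by (auto simp: tight_def)
    have ys: "y \<in> supp" and ya: "y \<noteq> a" and yb: "y \<noteq> b" and ab: "a \<noteq> b"
      using xyz(1) y a b s(1) by (auto simp: wall_def)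
    have yo: "y \<in> outer_set X" "y \<notin> ?I" using y by (auto simp: wall_def)
    have "wall (tight_hull a) = {y}"
      using wall_hull_of_tight[OF T(1) a yo(1)] inj[OF a(1) ys ya[symmetric]] by blast
    moreover have "wall (tight_hull b) = {y}"
      using wall_hull_of_tight[OF T(2) b(1), of y] b(2) yo V(2) inj[OF b(1) ys yb[symmetric]] by simp
    ultimately have "tight_hull a = tight_hull b" using common_wall[OF a(1) b(1) ys] by blast
    then show False using hull_eq_iff[OF a(1) b(1)] inj[OF a(1) b(1) ab] by blast
  qed
  then show thesis using that V by blast
qed

text \<open>A hull and its complement both have positive weight.\<close>

lemma wt_V_ne_1: "wt V \<noteq> 1"
proof
  assume 1: "wt V = 1"
  then obtain u where u: "u \<in> supp" using wt_pos_obtain[of V] by auto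
  show False
    using wt_three_parts[OF hull_proper[OF u]] hull_compl_ge[OF u] hull_wt_pos[OF u] 1
      wt_nonneg[of "wall (tight_hull u)"] by linarith
qed

lemma ex_split:
  assumes "2 \<le> wt V" "wt V \<noteq> 3"
  obtains u v where "u \<in> supp" "v \<in> supp" "u \<noteq> v"
    "minimal_extension V (add_mset (Upair u v) E) k (m(u := m u - 1, v := m v - 1))"
proof -
  have "\<not> blocked_extension V E k m"
    using blocked_extension.blocked_contradiction assms by blast
  then obtain u v where uv: "u \<in> supp" "v \<in> supp" "tight_hull u \<noteq> tight_hull v" "\<not> wall_related u v"
    "\<not> (\<exists>D. proper_biset V D \<and> surplus D \<le> 1 \<and> u \<in> inner_set D \<and> v \<in> inner_set D)"
    using minimal_extension_axioms unfolding blocked_extension_def blocked_extension_axioms_def by blast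
  then show thesis using that[OF uv(1,2)] split[OF uv(1-4)] by (metis not_le)
qed

end

text \<open>Each split trades two units of weight for one edge; only the final path, two edges for
  weight three, costs half an edge more, and this is the \<open>+ 1\<close>.\<close>

lemma minimal_extension_splitting:
  assumes "minimal_extension V E k m"
  shows "\<exists>F. multigraph V F \<and> (\<forall>X. proper_biset V X \<longrightarrow> 2 * k \<le> f_biset k (E + F) X)
    \<and> 2 * size F \<le> sum m V + 1"
  using assms
proof (induction "sum m V" arbitrary: m E rule: less_induct)
  case less
  interpret minimal_extension V E k m by fact
  consider "wt V = 0" | "wt V = 3" | "2 \<le> wt V" "wt V \<noteq> 3"
    using wt_V_ne_1 wt_nonneg[of V] by linarith
  then show ?case
  proof cases
    case 1
    have "2 * k \<le> f_biset k E X" if X: "proper_biset V X" for X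
      using covers_int[OF X] wt_mono[of "inner_set X" V] proper_subset[OF X] 1 by simp
    then show ?thesis by (intro exI[of _ "{#}"]) (auto simp: multigraph_def finite_V)
  next
    case 2
    obtain x y z where "x \<in> V" "y \<in> V" "z \<in> V"
      "\<And>X. proper_biset V X \<Longrightarrow> 2 * k \<le> f_biset k (E + {#Upair x y, Upair y z#}) X"
      using path_covers[OF 2] by blast
    moreover have "sum m V = 3" using 2 unfolding wt_def by linarith
    ultimately show ?thesis
      by (intro exI[of _ "{#Upair x y, Upair y z#}"]) (auto simp: multigraph_def finite_V)
  next
    case 3
    then obtain u v where uv: "u \<in> supp" "v \<in> supp" "u \<noteq> v"
      "minimal_extension V (add_mset (Upair u v) E) k (m(u := m u - 1, v := m v - 1))"
      using ex_split by metis
    let ?m = "m(u := m u - 1, v := m v - 1)"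
    have mem: "u \<in> V" "v \<in> V" "0 < m u" "0 < m v" using uv by (auto simp: supp_def)
    have "sum ?m V + 1 = sum (m(u := m u - 1)) V"
      using sum_decrease[OF finite_V, of "m(u := m u - 1)" v] mem uv(3) by simp
    moreover have "sum (m(u := m u - 1)) V + 1 = sum m V"
      using sum_decrease[OF finite_V, of m u] mem by simp
    ultimately have s: "sum ?m V + 2 = sum m V" by linarith
    then obtain F where F: "multigraph V F"
      "\<And>X. proper_biset V X \<Longrightarrow> 2 * k \<le> f_biset k (add_mset (Upair u v) E + F) X"
      "2 * size F \<le> sum ?m V + 1"
      using less.hyps[OF _ uv(4)] by (metis less_add_same_cancel1 zero_less_numeral)
    have "add_mset (Upair u v) E + F = E + add_mset (Upair u v) F" by simp
    then have "2 * k \<le> f_biset k (E + add_mset (Upair u v) F) X" if "proper_biset V X" for X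
      using F(2)[OF that] by simp
    moreover have "multigraph V (add_mset (Upair u v) F)"
      using F(1) mem by (auto simp: multigraph_def)
    moreover have "2 * size (add_mset (Upair u v) F) \<le> sum m V + 1" using F(3) s by simp
    ultimately show ?thesis by blast
  qed
qed

section \<open>A disjoint family of deficiency at least the total weight\<close>

lemma (in extension) wt_UN_le:
  assumes "finite \<F>" "\<And>X. X \<in> \<F> \<Longrightarrow> inner_set X \<subseteq> V"
  shows "wt (\<Union>X\<in>\<F>. inner_set X) \<le> (\<Sum>X\<in>\<F>. wt (inner_set X))"
  using assms
proof (induction \<F> rule: finite_induct)
  case (insert X \<F>)
  have "inner_set X \<subseteq> V" "(\<Union>X\<in>\<F>. inner_set X) \<subseteq> V" using insert.prems by blast+
  then have "wt (inner_set X \<union> (\<Union>X\<in>\<F>. inner_set X)) \<le> wt (inner_set X) + wt (\<Union>X\<in>\<F>. inner_set X)"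
    using wt_Un[of "inner_set X" "\<Union>X\<in>\<F>. inner_set X"]
      wt_nonneg[of "inner_set X \<inter> (\<Union>X\<in>\<F>. inner_set X)"] by linarith
  then show ?case using insert by simp
qed simp

text \<open>Hulls may overlap in weight zero, so they are only a starting point. In a tight family
  covering \<open>supp\<close> with least total inner size, intersecting members could be replaced
  by their union or by their differences at lower cost.\<close>

lemma (in minimal_extension) tight_family:
  obtains \<F> where "\<F> \<in> admissible_families V" "wt V \<le> (\<Sum>X\<in>\<F>. 2 * int k - int (f_biset k E X))"
proof -
  define P where "P \<F> \<longleftrightarrow> finite \<F> \<and> (\<forall>X\<in>\<F>. tight X) \<and> supp \<subseteq> (\<Union>X\<in>\<F>. inner_set X)" for \<F>
  \<comment> \<open>every uncrossing step strictly decreases this weight\<close>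
  let ?w = "\<lambda>\<F>. \<Sum>X\<in>\<F>. card (inner_set X)"
  have "P (tight_hull ` supp)"
    unfolding P_def using finite_supp tight_hull(1,2) by blast
  then have "\<exists>\<F>. P \<F> \<and> (\<forall>\<G>. P \<G> \<longrightarrow> ?w \<F> \<le> ?w \<G>)"
    by (rule ex_has_least_nat)
  then obtain \<F> where \<F>: "P \<F>" and least: "\<And>\<G>. P \<G> \<Longrightarrow> ?w \<F> \<le> ?w \<G>" by blast
  have fin: "finite \<F>" and T: "\<And>X. X \<in> \<F> \<Longrightarrow> tight X" and cov: "supp \<subseteq> (\<Union>X\<in>\<F>. inner_set X)"
    using \<F> unfolding P_def by blast+
  have replace: "card (inner_set X) + card (inner_set Y) \<le> ?w \<G>"
    if XY: "X \<in> \<F>" "Y \<in> \<F>" "X \<noteq> Y" and G: "finite \<G>" "\<And>Z. Z \<in> \<G> \<Longrightarrow> tight Z"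
      "supp \<inter> (inner_set X \<union> inner_set Y) \<subseteq> (\<Union>Z\<in>\<G>. inner_set Z)" for X Y \<G>
  proof -
    let ?H = "\<F> - {X, Y}"
    have "P (?H \<union> \<G>)"
      unfolding P_def
    proof (intro conjI ballI subsetI)
      fix c assume c: "c \<in> supp"
      then obtain A where A: "A \<in> \<F>" "c \<in> inner_set A" using cov by blast
      show "c \<in> (\<Union>Z\<in>?H \<union> \<G>. inner_set Z)"
      proof (cases "A \<in> {X, Y}")
        case True
        then have "c \<in> supp \<inter> (inner_set X \<union> inner_set Y)" using A c by auto
        then show ?thesis using G(3) by blast
      next
        case False
        then show ?thesis using A by blast
      qed
    qed (use fin T G(1,2) in auto)
    then have "?w \<F> \<le> ?w (?H \<union> \<G>)" by (rule least)
    also have "\<dots> \<le> ?w ?H + ?w \<G>"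
      using sum.union_inter[of ?H \<G> "\<lambda>X. card (inner_set X)"] fin G(1) by simp
    finally have "?w \<F> \<le> ?w ?H + ?w \<G>" .
    moreover have "?w \<F> = ?w ?H + (card (inner_set X) + card (inner_set Y))"
      using sum.subset_diff[of "{X, Y}" \<F> "\<lambda>X. card (inner_set X)"] fin XY by simp
    ultimately show ?thesis by linarith
  qed
  have disj: "inner_set X \<inter> inner_set Y = {}" if XY: "X \<in> \<F>" "Y \<in> \<F>" "X \<noteq> Y" for X Y
  proof (rule ccontr)
    assume ne: "inner_set X \<inter> inner_set Y \<noteq> {}"
    have tX: "tight X" and tY: "tight Y" using T XY by auto
    have p: "proper_biset V X" "proper_biset V Y" and s0: "surplus X = 0" "surplus Y = 0"
      using tX tY by (auto simp: tight_def)
    note fi = proper_finite(2)[OF p(1)] proper_finite(2)[OF p(2)]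
    have pos: "0 < card (inner_set X)" "0 < card (inner_set Y)"
      using proper_subset(4)[OF p(1)] proper_subset(4)[OF p(2)] fi by (auto simp: card_gt_0_iff)
    \<comment> \<open>Otherwise \<open>A\<close> could be dropped, since \<open>B\<close> covers its
      share of \<open>supp\<close>.\<close>
    have useful: "\<exists>a \<in> supp. a \<in> inner_set A \<and> a \<notin> inner_set B"
      if AB: "A \<in> \<F>" "B \<in> \<F>" "A \<noteq> B" "0 < card (inner_set A)" for A B
    proof (rule ccontr)
      assume "\<not> ?thesis"
      then have "supp \<inter> (inner_set A \<union> inner_set B) \<subseteq> (\<Union>Z\<in>{B}. inner_set Z)" by blast
      then show False using replace[OF AB(1-3), of "{B}"] T[OF AB(2)] AB(4) by simp
    qed
    obtain a where a: "a \<in> supp" "a \<in> inner_set X" "a \<notin> inner_set Y"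
      using useful[OF XY pos(1)] by blast
    obtain b where b: "b \<in> supp" "b \<in> inner_set Y" "b \<notin> inner_set X"
      using useful[OF XY(2,1) XY(3)[symmetric] pos(2)] by blast
    have w: "card (wall X) \<le> 1" "card (wall Y) \<le> 1"
      using tight_wall[OF tX a(1,2)] tight_wall[OF tY b(1,2)] by auto
    have un: "outer_set X \<union> outer_set Y = V"
    proof (rule ccontr)
      assume "\<not> ?thesis"
      then have "tight (bi_union X Y)" using tight_union[OF tX tY ne] by blast
      then have "card (inner_set X) + card (inner_set Y) \<le> card (inner_set X \<union> inner_set Y)"
        using replace[OF XY, of "{bi_union X Y}"] by simp
      moreover have "0 < card (inner_set X \<inter> inner_set Y)" using ne fi by (simp add: card_gt_0_iff)
      ultimately show False using card_Un_Int[OF fi] by linarith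
    qed
    have wX: "1 \<le> wt (inner_set X)" "1 \<le> wt (inner_set Y)"
      using wt_ge_1[OF a(1,2) proper_subset(3)[OF p(1)]] wt_ge_1[OF b(1,2) proper_subset(3)[OF p(2)]] .
    have n1: "\<not> inner_set X \<subseteq> outer_set Y"
      using crossing_cover[OF p(1) w(1) p(2) w(2) un] s0 wX a wt_nonneg[of "inner_set X \<inter> inner_set Y"]
      by fastforce
    have n2: "\<not> inner_set Y \<subseteq> outer_set X"
      using crossing_cover[OF p(2) w(2) p(1) w(1)] un s0 wX b wt_nonneg[of "inner_set Y \<inter> inner_set X"]
      by (fastforce simp: Un_commute)
    have pd: "proper_biset V (bi_diff X Y)" "proper_biset V (bi_diff Y X)"
      using proper_diff p n1 n2 by auto
    note le = surplus_diff[OF p] surplus_nonneg[OF pd(1)] surplus_nonneg[OF pd(2)] s0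
      wt_nonneg[of "inner_set X \<inter> outer_set Y"] wt_nonneg[of "inner_set Y \<inter> outer_set X"]
    have z: "surplus (bi_diff X Y) = 0" "surplus (bi_diff Y X) = 0"
      "wt (inner_set X \<inter> outer_set Y) = 0" "wt (inner_set Y \<inter> outer_set X) = 0"
      using le by linarith+
    have nm: "c \<notin> inner_set X \<inter> outer_set Y" "c \<notin> inner_set Y \<inter> outer_set X" if "c \<in> supp" for c
      using z(3,4) wt_ge_1[OF that, of "inner_set X \<inter> outer_set Y"] wt_ge_1[OF that, of "inner_set Y \<inter> outer_set X"]
        proper_subset(3)[OF p(1)] proper_subset(3)[OF p(2)] by auto
    \<comment> \<open>Passing to the differences gives up only overlaps of weight zero, hence no
      vertex of \<open>supp\<close>.\<close>
    have "card (inner_set X) + card (inner_set Y) \<le> ?w {bi_diff X Y, bi_diff Y X}"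
      using pd z nm by (intro replace[OF XY]) (auto simp: tight_def)
    also have "\<dots> \<le> card (inner_set X - outer_set Y) + card (inner_set Y - outer_set X)"
      by (cases "bi_diff X Y = bi_diff Y X") auto
    finally have "card (inner_set X) + card (inner_set Y)
      \<le> card (inner_set X - outer_set Y) + card (inner_set Y - outer_set X)" .
    moreover have "card (inner_set X - outer_set Y) < card (inner_set X)"
      using ne proper_subset(1)[OF p(2)] fi by (intro psubset_card_mono) auto
    moreover have "card (inner_set Y - outer_set X) \<le> card (inner_set Y)"
      using fi by (intro card_mono) auto
    ultimately show False by linarith
  qed
  have "\<F> \<in> admissible_families V"
    unfolding admissible_families_def pairwise_def innerly_disjoint_def
    using disj T by (auto simp: tight_def proper_biset_def)
  moreover have "wt V \<le> (\<Sum>X\<in>\<F>. 2 * int k - int (f_biset k E X))"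
  proof -
    have sub: "inner_set X \<subseteq> V" if "X \<in> \<F>" for X
      using proper_subset(3)[OF tight_proper[OF T[OF that]]] .
    have "wt V \<le> wt (\<Union>X\<in>\<F>. inner_set X)"
      using cov sub by (intro wt_mono_supp) auto
    also have "\<dots> \<le> (\<Sum>X\<in>\<F>. wt (inner_set X))" using wt_UN_le[OF fin sub] .
    also have "\<dots> = (\<Sum>X\<in>\<F>. 2 * int k - int (f_biset k E X))"
    proof (rule sum.cong)
      fix X assume "X \<in> \<F>"
      from T[OF this] show "wt (inner_set X) = 2 * int k - int (f_biset k E X)"
        unfolding tight_def surplus_def by linarith
    qed simp
    finally show ?thesis .
  qed
  ultimately show thesis by (rule that)
qed

section \<open>The lower bound and the formula\<close>

lemma sum_degree_disjoint_le:
  assumes "finite \<F>" "pairwise innerly_disjoint \<F>"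
  shows "(\<Sum>X\<in>\<F>. biset_degree F X) \<le> 2 * size F"
proof (induction F)
  case (add e F)
  obtain a b where e: "e = Upair a b" by (cases e)
  \<comment> \<open>Each end-vertex lies in at most one of the disjoint inner sets, so an edge
    enters at most two members: the origin of the factor one half in \<open>alpha\<close>.\<close>
  have one: "(\<Sum>X\<in>\<F>. of_bool (c \<in> inner_set X)) \<le> (1 :: nat)" for c
  proof -
    have "(\<Sum>X\<in>\<F>. of_bool (c \<in> inner_set X)) = card {X \<in> \<F>. c \<in> inner_set X}"
      using assms(1) by (simp add: Int_def)
    moreover have "card {X \<in> \<F>. c \<in> inner_set X} \<le> Suc 0"
    proof (subst card_le_Suc0_iff_eq)
      show "\<forall>X\<in>{X \<in> \<F>. c \<in> inner_set X}. \<forall>Y\<in>{X \<in> \<F>. c \<in> inner_set X}. X = Y"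
        using assms(2) unfolding pairwise_def innerly_disjoint_def by blast
    qed (use assms(1) in simp)
    ultimately show ?thesis by simp
  qed
  have "(\<Sum>X\<in>\<F>. of_bool (enters e X))
      \<le> (\<Sum>X\<in>\<F>. of_bool (a \<in> inner_set X) + (of_bool (b \<in> inner_set X) :: nat))"
    unfolding e by (intro sum_mono) auto
  also have "\<dots> \<le> 2" using one[of a] one[of b] by (simp add: sum.distrib)
  finally have "(\<Sum>X\<in>\<F>. of_bool (enters e X)) \<le> (2 :: nat)" .
  moreover have "(\<Sum>X\<in>\<F>. biset_degree (add_mset e F) X)
      = (\<Sum>X\<in>\<F>. of_bool (enters e X)) + (\<Sum>X\<in>\<F>. biset_degree F X)"
    unfolding biset_degree_add_mset by (rule sum.distrib)
  ultimately show ?case using add.IH by simp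
qed simp

lemma augmentation_iff:
  assumes "multigraph V E" "card V \<ge> 3" "multigraph V F"
  shows "augmentation k V E F \<longleftrightarrow> (\<forall>X. proper_biset V X \<longrightarrow> 2 * k \<le> f_biset k (E + F) X)"
proof -
  have "multigraph V (E + F)" using assms by (auto simp: multigraph_def)
  then show ?thesis using two_k_k_connected_iff assms by (auto simp: augmentation_def)
qed

text \<open>Each member must be entered by at least as many edges of \<open>F\<close> as its
  deficiency, and one edge serves at most two members.\<close>

lemma augmentation_lower_bound:
  assumes "multigraph V E" "card V \<ge> 3" and F: "augmentation k V E F" and X: "\<X> \<in> admissible_families V"
  shows "(\<Sum>X\<in>\<X>. 2 * int k - int (f_biset k E X)) \<le> 2 * int (size F)"
proof -
  have mF: "multigraph V F" using F by (simp add: augmentation_def)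
  have cov: "2 * k \<le> f_biset k (E + F) X" if "proper_biset V X" for X
    using augmentation_iff[OF assms(1,2) mF] F that by blast
  have "\<X> \<subseteq> Pow V \<times> Pow V"
    using X unfolding admissible_families_def is_biset_def by fastforce
  then have fin: "finite \<X>"
    by (rule finite_subset) (use assms(1) in \<open>simp add: multigraph_def\<close>)
  have "(\<Sum>X\<in>\<X>. 2 * int k - int (f_biset k E X)) \<le> (\<Sum>X\<in>\<X>. int (biset_degree F X))"
  proof (rule sum_mono)
    fix A assume "A \<in> \<X>"
    then have "proper_biset V A" using X by (auto simp: admissible_families_def proper_biset_def)
    from cov[OF this] show "2 * int k - int (f_biset k E A) \<le> int (biset_degree F A)"
      unfolding f_biset_def biset_degree_union by linarith
  qed
  also have "\<dots> = int (\<Sum>X\<in>\<X>. biset_degree F X)" by simp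
  also have "\<dots> \<le> int (2 * size F)"
    using sum_degree_disjoint_le[OF fin, of F] X unfolding admissible_families_def
    by (simp del: of_nat_sum)
  finally show ?thesis by simp
qed

theorem theorem8p3:
  fixes V :: "'a set" and E :: "'a uprod multiset" and k :: nat
  assumes "multigraph V E"
    and "card V \<ge> 3"
    and "k \<ge> 2"
  shows "\<exists>F. is_arg_min size (augmentation k V E) F \<and> int (size F) = alpha k V E"
proof -
  let ?p = "\<lambda>\<X>. \<Sum>X\<in>\<X>. 2 * int k - int (f_biset k E X)"
  define M where "M = Max (?p ` admissible_families V)"
  have fin: "finite (?p ` admissible_families V)"
    using finite_admissible_families assms(1) by (auto simp: multigraph_def)
  obtain m where m: "minimal_extension V E k m"
    using ex_minimal_extension[OF assms(1,3)] by blast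
  then interpret minimal_extension V E k m .
  obtain F where F: "multigraph V F" "\<forall>X. proper_biset V X \<longrightarrow> 2 * k \<le> f_biset k (E + F) X"
    "2 * size F \<le> sum m V + 1"
    using minimal_extension_splitting[OF m] by blast
  have aug: "augmentation k V E F" using augmentation_iff[OF assms(1,2) F(1)] F(2) by blast
  obtain \<F> where \<F>: "\<F> \<in> admissible_families V" "wt V \<le> ?p \<F>" using tight_family by blast
  have "?p \<F> \<le> M" unfolding M_def using fin \<F>(1) by (intro Max_ge) auto
  then have upper: "2 * int (size F) \<le> M + 1" using F(3) \<F>(2) unfolding wt_def by linarith
  have "M \<in> ?p ` admissible_families V"
    unfolding M_def using fin empty_admissible by (intro Max_in) auto
  then have lower: "M \<le> 2 * int (size F')" if "augmentation k V E F'" for F'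
    using augmentation_lower_bound[OF assms(1,2) that] by blast
  have "is_arg_min size (augmentation k V E) F"
    unfolding is_arg_min_def
  proof (intro conjI notI)
    assume "\<exists>F'. augmentation k V E F' \<and> size F' < size F"
    then obtain F' where "augmentation k V E F'" "size F' < size F" by blast
    \<comment> \<open>One edge less gives
      \<open>2 * size F' \<le> 2 * size F - 2 < M\<close>.\<close>
    then show False using lower[of F'] upper by linarith
  qed (rule aug)
  \<comment> \<open>\<open>2 * size F\<close> is \<open>M\<close> or \<open>M + 1\<close>, so
    \<open>size F\<close> is half of \<open>M\<close> rounded up.\<close>
  moreover have "\<lceil>real_of_int M / 2\<rceil> = int (size F)"
    using lower[OF aug] upper by (intro ceiling_unique) linarith+
  then have "int (size F) = alpha k V E" by (simp add: alpha_def M_def)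
  ultimately show ?thesis by blast
qed

end
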